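(* There exist a constant $c>0$ and a function $q:\mathbb{N}\to\mathbb{N}$ such that for every $k\in\mathbb{N}$ (with $k\ge 1$) and all sufficiently large $t$ (depending on $k$) the following hold: (a) $r_{2k+1}\big(\hat H_t^{(2k+1)};2\big)\le t^{k+3}$; and (b) if $k\geq 2$ and $\lfloor c\log_2\log_2 k\rfloor\ge 1$, then $r_{2k+1}\big(\hat H_t^{(2k+1)};q(k)\big)\ge T_{\lfloor c\log_2\log_2 k\rfloor}(t)$.
   Context: $K_n^{(k)}$ is the complete $k$-uniform hypergraph on $n$ vertices. For a $k$-uniform hypergraph $G$ and $q\in\mathbb N$, $r_k(G;q)$ is the smallest integer $n$ such that in every colouring of the edges of $K_n^{(k)}$ with $q$ colours there is a (not necessarily induced) copy of $G$ all of whose edges have the same colour. The $k$-uniform balanced hedgehog $\hat H_t^{(k)}$ with body of order $t$ is the following $k$-uniform hypergraph: take a set $S$ of $t$ vertices (the body), and for each subset $X\subset S$ with $|X|=\lceil k/2\rceil$ add one $k$-edge $e$ with $e\cap S=X$, in such a way that any two distinct edges $e,f$ satisfy $e\cap f\subset S$. The vertex set consists of $S$ and the vertices of these edges. (So $\hat H_t^{(2k+1)}$ has one edge for each $(k+1)$-subset of its body.) The tower function is defined by $T_1(x)=x$ and $T_{i+1}(x)=2^{T_i(x)}$. *)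

theory Defs
  imports Complex_Main "HOL-Library.Ramsey"
begin

text \<open>A hypergraph is given by its vertex set and its edge set.\<close>

type_synonym 'a hypergraph = "'a set \<times> 'a set set"

abbreviation verts :: "'a hypergraph \<Rightarrow> 'a set" where "verts \<equiv> fst"
abbreviation edges :: "'a hypergraph \<Rightarrow> 'a set set" where "edges \<equiv> snd"

definition uniform_hypergraph :: "nat \<Rightarrow> 'a hypergraph \<Rightarrow> bool" where
  "uniform_hypergraph k G \<longleftrightarrow> finite (verts G) \<and> edges G \<subseteq> [verts G]\<^bsup>k\<^esup>"

definition complete_hypergraph :: "nat \<Rightarrow> nat \<Rightarrow> nat hypergraph" where
  "complete_hypergraph k n = ({..<n}, [{..<n}]\<^bsup>k\<^esup>)"

text \<open>A copy of \<open>G\<close> in \<open>H\<close>, not necessarily induced, is the image of \<open>G\<close> under an embedding.\<close>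

definition embedding :: "('a \<Rightarrow> 'b) \<Rightarrow> 'a hypergraph \<Rightarrow> 'b hypergraph \<Rightarrow> bool" where
  "embedding f G H \<longleftrightarrow>
     inj_on f (verts G) \<and> f ` verts G \<subseteq> verts H \<and> (\<forall>e\<in>edges G. f ` e \<in> edges H)"

definition ramsey_arrows :: "nat \<Rightarrow> 'a hypergraph \<Rightarrow> nat \<Rightarrow> nat \<Rightarrow> bool" where
  "ramsey_arrows k G q n \<longleftrightarrow>
     (\<forall>\<chi> \<in> edges (complete_hypergraph k n) \<rightarrow> {..<q}.
        \<exists>f i. embedding f G (complete_hypergraph k n) \<and> (\<forall>e\<in>edges G. \<chi> (f ` e) = i))"

text \<open>For a \<open>k\<close>-uniform \<open>G\<close> the minimum is over a nonempty set, see \<open>ramsey_arrows_ex\<close>.\<close>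

definition ramsey_number :: "nat \<Rightarrow> 'a hypergraph \<Rightarrow> nat \<Rightarrow> nat" where
  "ramsey_number k G q = (LEAST n. ramsey_arrows k G q n)"

lemma ramsey_arrows_ex:
  assumes "uniform_hypergraph k G"
  shows "\<exists>n. ramsey_arrows k G q n"
proof -
  define m where "m = card (verts G)"
  obtain N :: nat where N: "partn_lst {..<N} (replicate q m) k"
    using ramsey_full by blast
  have "\<exists>f i. embedding f G (complete_hypergraph k N) \<and> (\<forall>e\<in>edges G. \<chi> (f ` e) = i)"
    if chi: "\<chi> \<in> [{..<N}]\<^bsup>k\<^esup> \<rightarrow> {..<q}" for \<chi>
  proof -
    obtain i where i: "i < q" "monochromatic {..<N} m k \<chi> i"
      using N chi by (auto simp: partn_lst_def)
    then obtain H where H: "H \<subseteq> {..<N}" "finite H" "card H = m"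
      and mono: "\<chi> ` ([H]\<^bsup>k\<^esup>) \<subseteq> {i}"
      unfolding monochromatic_def nsets_def by blast
    have fin: "finite (verts G)" and E: "edges G \<subseteq> [verts G]\<^bsup>k\<^esup>"
      using assms by (auto simp: uniform_hypergraph_def)
    obtain f where f: "bij_betw f (verts G) H"
      using finite_same_card_bij[OF fin H(2)] H(3) by (auto simp: m_def)
    then have inj: "inj_on f (verts G)" and im: "f ` verts G = H"
      by (auto simp: bij_betw_def)
    have edge: "f ` e \<in> [H]\<^bsup>k\<^esup>" if "e \<in> edges G" for e
    proof -
      have "e \<subseteq> verts G" "finite e" "card e = k"
        using that E by (auto simp: nsets_def)
      moreover from this have "card (f ` e) = k"
        using inj by (simp add: card_image inj_on_subset)
      ultimately show ?thesis
        using im by (auto simp: nsets_def)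
    qed
    have sub: "[H]\<^bsup>k\<^esup> \<subseteq> [{..<N}]\<^bsup>k\<^esup>"
      using H(1) by (auto simp: nsets_def)
    have "embedding f G (complete_hypergraph k N)"
      using inj im H(1) edge sub by (simp add: embedding_def complete_hypergraph_def subset_iff)
    moreover have "\<forall>e\<in>edges G. \<chi> (f ` e) = i"
      using mono edge by blast
    ultimately show ?thesis
      by blast
  qed
  then have "ramsey_arrows k G q N"
    by (simp add: ramsey_arrows_def complete_hypergraph_def)
  then show ?thesis ..
qed

text \<open>
  The body consists of the vertices \<open>Inl i\<close> with \<open>i < t\<close>, and \<open>\<lceil>k/2\<rceil> = (k + 1) div 2\<close>. The edge
  belonging to a set \<open>X\<close> of body vertices contains \<open>X\<close> and \<open>k - \<lceil>k/2\<rceil>\<close> private vertices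
  \<open>Inr (X, j)\<close>.
\<close>

type_synonym hedgehog_vertex = "nat + nat set \<times> nat"

definition hedgehog_body :: "nat \<Rightarrow> hedgehog_vertex set" where
  "hedgehog_body t = Inl ` {..<t}"

definition hedgehog_edge :: "nat \<Rightarrow> nat set \<Rightarrow> hedgehog_vertex set" where
  "hedgehog_edge k X = Inl ` X \<union> (\<lambda>j. Inr (X, j)) ` {..<k - (k + 1) div 2}"

definition balanced_hedgehog :: "nat \<Rightarrow> nat \<Rightarrow> hedgehog_vertex hypergraph" where
  "balanced_hedgehog k t =
     (let E = hedgehog_edge k ` ([{..<t}]\<^bsup>((k + 1) div 2)\<^esup>) in (hedgehog_body t \<union> \<Union>E, E))"

lemma card_hedgehog_body: "card (hedgehog_body t) = t"
  by (simp add: hedgehog_body_def card_image)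

lemma hedgehog_edge_Int_body:
  "X \<subseteq> {..<t} \<Longrightarrow> hedgehog_edge k X \<inter> hedgehog_body t = Inl ` X"
  by (auto simp: hedgehog_edge_def hedgehog_body_def)

lemma balanced_hedgehog_unique_edge:
  assumes "X \<in> [hedgehog_body t]\<^bsup>((k + 1) div 2)\<^esup>"
  shows "\<exists>!e. e \<in> edges (balanced_hedgehog k t) \<and> e \<inter> hedgehog_body t = X"
proof -
  obtain Y where Y: "Y \<subseteq> {..<t}" "X = Inl ` Y"
    using assms by (auto simp: nsets_def hedgehog_body_def subset_image_iff)
  then have "Y \<in> [{..<t}]\<^bsup>((k + 1) div 2)\<^esup>"
    using assms by (auto simp: nsets_def card_image finite_image_iff)
  moreover have "Z = Y"
    if "Z \<in> [{..<t}]\<^bsup>((k + 1) div 2)\<^esup>" "hedgehog_edge k Z \<inter> hedgehog_body t = X" for Z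
    using that Y hedgehog_edge_Int_body[of Z t k] by (auto simp: nsets_def inj_image_eq_iff)
  ultimately show ?thesis
    using Y hedgehog_edge_Int_body[of Y t k]
    by (intro ex1I[of _ "hedgehog_edge k Y"]) (auto simp: balanced_hedgehog_def Let_def)
qed

lemma balanced_hedgehog_edge_Int_body:
  assumes "e \<in> edges (balanced_hedgehog k t)"
  shows "e \<inter> hedgehog_body t \<in> [hedgehog_body t]\<^bsup>((k + 1) div 2)\<^esup>"
proof -
  obtain X where X: "e = hedgehog_edge k X" "X \<in> [{..<t}]\<^bsup>((k + 1) div 2)\<^esup>"
    using assms by (auto simp: balanced_hedgehog_def Let_def)
  then have "e \<inter> hedgehog_body t = Inl ` X"
    using hedgehog_edge_Int_body[of X t k] by (auto simp: nsets_def)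
  then show ?thesis
    using X by (auto simp: nsets_def card_image hedgehog_body_def)
qed

lemma balanced_hedgehog_edges_Int:
  assumes "e \<in> edges (balanced_hedgehog k t)" "f \<in> edges (balanced_hedgehog k t)" "e \<noteq> f"
  shows "e \<inter> f \<subseteq> hedgehog_body t"
proof -
  obtain X Y where "e = hedgehog_edge k X" "f = hedgehog_edge k Y" "X \<subseteq> {..<t}"
    using assms(1,2) by (auto simp: balanced_hedgehog_def Let_def nsets_def)
  moreover from this have "X \<noteq> Y"
    using assms(3) by blast
  ultimately show ?thesis
    by (auto simp: hedgehog_edge_def hedgehog_body_def)
qed

lemma uniform_balanced_hedgehog: "uniform_hypergraph k (balanced_hedgehog k t)"
proof -
  have card: "finite (hedgehog_edge k X) \<and> card (hedgehog_edge k X) = k"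
    if "X \<in> [{..<t}]\<^bsup>((k + 1) div 2)\<^esup>" for X
  proof -
    have "card (hedgehog_edge k X)
        = card (Inl ` X :: hedgehog_vertex set)
          + card ((\<lambda>j. Inr (X, j)) ` {..<k - (k + 1) div 2} :: hedgehog_vertex set)"
      unfolding hedgehog_edge_def using that by (intro card_Un_disjoint) (auto simp: nsets_def)
    also have "\<dots> = card X + (k - (k + 1) div 2)"
      by (simp add: card_image inj_on_def)
    finally show ?thesis
      using that by (auto simp: nsets_def hedgehog_edge_def)
  qed
  have "finite ([{..<t}]\<^bsup>((k + 1) div 2)\<^esup>)"
    by (simp add: finite_imp_finite_nsets)
  then show ?thesis
    using card unfolding uniform_hypergraph_def balanced_hedgehog_def Let_def
    by (auto simp: hedgehog_body_def) (auto simp: nsets_def)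
qed

text \<open>Indexing starts at 1; the value at index 0 is left unspecified.\<close>

fun tower :: "nat \<Rightarrow> nat \<Rightarrow> nat" where
  "tower (Suc 0) x = x"
| "tower (Suc (Suc i)) x = 2 ^ tower (Suc i) x"

end

theory Submission
  imports Defs "HOL-Library.Disjoint_Sets" "HOL-Real_Asymp.Real_Asymp"
begin

text \<open>
  Lower bound. Vertices are read as binary expansions, hence as leaves of a binary tree; the levels
  at which the elements of a set split form a set of exponentially smaller numbers, to which the
  same construction applies again. An edge is coloured by its similarity type: the order pattern of
  the split levels, iterated \<open>h\<close> times. If all edges at a body \<open>S\<close> have the same type, then every
  small subset of \<open>S\<close> is similar to a subset of one fixed edge \<open>Q\<close>. If \<open>S\<close> is large, it contains
  a long comb or a large full binary tree. In the second case \<open>Q\<close> contains an increasing comb and a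
  decreasing comb that together nearly exhaust it, and a full tree, which meets each comb in few
  points, so that there is no room for all three. In the first case the argument continues with the
  split levels of the comb and of \<open>Q\<close>. Each step costs only a root of the size of \<open>S\<close>, whereas the
  ground set shrinks to its logarithm.

  Upper bound. A \<open>(k + 1)\<close>-set is bad for a colour if a set of \<open>O(t^(k+1))\<close> vertices meets all its
  petals of that colour. For every vertex \<open>v\<close> there is a colour such that \<open>O(t^(k+1))\<close> vertices meet
  \<open>X - {v}\<close> for every bad set \<open>X\<close> of that colour through \<open>v\<close>: otherwise large disjoint families of
  both kinds yield bad sets \<open>X\<close> and \<open>Y\<close>, one for each colour, such that \<open>X \<union> Y\<close> is an edge of
  neither colour. The same colour serves at least half of the vertices, and a \<open>t\<close>-set among them
  that is independent with respect to the covers contains no bad set of that colour.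
\<close>

section \<open>The level at which two binary expansions split\<close>

text \<open>For distinct numbers this is the highest binary position in which they differ, that is,
  the height of their branching point. Equal arguments give the default 0, so the definitions below
  use levels of pairs \<open>x < y\<close> only.\<close>

definition split_level :: "nat \<Rightarrow> nat \<Rightarrow> nat" where
  "split_level x y = (LEAST i. x div 2 ^ Suc i = y div 2 ^ Suc i)"

text \<open>Once two quotients agree they agree at all higher levels, since dividing by a higher
  power of 2 is repeated division. So the least level of agreement is a threshold.\<close>

lemma split_level_le_iff: "split_level x y \<le> i \<longleftrightarrow> x div 2 ^ Suc i = y div 2 ^ Suc i"
proof
  have "x < 2 ^ Suc (x + y)" "y < 2 ^ Suc (x + y)"
    using less_exp[of "Suc (x + y)"] by linarith+
  then have "x div 2 ^ Suc (x + y) = y div 2 ^ Suc (x + y)"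
    by simp
  then have *: "x div 2 ^ Suc (split_level x y) = y div 2 ^ Suc (split_level x y)"
    unfolding split_level_def by (rule LeastI)
  assume "split_level x y \<le> i"
  then have "(2::nat) ^ Suc i = 2 ^ Suc (split_level x y) * 2 ^ (i - split_level x y)"
    by (simp flip: power_add)
  then show "x div 2 ^ Suc i = y div 2 ^ Suc i"
    using * by (simp only: div_mult2_eq)
next
  assume "x div 2 ^ Suc i = y div 2 ^ Suc i"
  then show "split_level x y \<le> i"
    unfolding split_level_def by (rule Least_le)
qed

lemma split_level_less:
  assumes "x < y" "y < 2 ^ N"
  shows "split_level x y < N"
proof -
  obtain M where M: "N = Suc M"
    using assms by (cases N) auto
  have "split_level x y \<le> M"
    unfolding split_level_le_iff using assms by (simp add: M)
  then show ?thesis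
    by (simp add: M)
qed

text \<open>Dropping low bits preserves the order, so the quotient of \<open>y\<close> is squeezed
  between those of \<open>x\<close> and \<open>z\<close>: the outer two agree exactly if both
  neighbouring pairs do.\<close>

lemma split_level_max:
  assumes "x < y" "y < z"
  shows "split_level x z = max (split_level x y) (split_level y z)"
proof -
  have "split_level x z \<le> i \<longleftrightarrow> max (split_level x y) (split_level y z) \<le> i" for i
  proof -
    have "x div 2 ^ Suc i \<le> y div 2 ^ Suc i" "y div 2 ^ Suc i \<le> z div 2 ^ Suc i"
      using assms by (simp_all add: div_le_mono)
    then show ?thesis
      unfolding max.bounded_iff split_level_le_iff by linarith
  qed
  then show ?thesis
    by (meson order.antisym order.refl)
qed

text \<open>The tree is binary: if both levels were \<open>i\<close>, dropping \<open>i\<close> bits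
  would leave three increasing numbers with the same half, but only two numbers share a
  half.\<close>

lemma split_level_neq:
  assumes "x < y" "y < z"
  shows "split_level x y \<noteq> split_level y z"
proof
  assume eq: "split_level x y = split_level y z"
  define i where "i = split_level x y"
  have 1: "x div 2 ^ Suc i = y div 2 ^ Suc i" "y div 2 ^ Suc i = z div 2 ^ Suc i"
    using split_level_le_iff[of x y i] split_level_le_iff[of y z i] eq by (simp_all add: i_def)
  have less: "u div 2 ^ i < v div 2 ^ i" if "u < v" "split_level u v = i" for u v
  proof -
    have "u div 2 ^ i \<noteq> v div 2 ^ i"
    proof (cases i)
      case 0
      then show ?thesis using that by simp
    next
      case (Suc j)
      then show ?thesis using split_level_le_iff[of u v j] that by auto
    qed
    moreover have "u div 2 ^ i \<le> v div 2 ^ i"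
      using that by (simp add: div_le_mono)
    ultimately show ?thesis by simp
  qed
  have 2: "x div 2 ^ i < y div 2 ^ i" "y div 2 ^ i < z div 2 ^ i"
    using less assms eq by (auto simp: i_def)
  have "u div 2 ^ Suc i = u div 2 ^ i div 2" for u :: nat
    by (simp only: power_Suc2 div_mult2_eq)
  then show False
    using 1 2 by simp
qed

definition split_levels :: "nat set \<Rightarrow> nat set" where
  "split_levels A = {split_level x y | x y. x \<in> A \<and> y \<in> A \<and> x < y}"

lemma split_levelsI: "x \<in> A \<Longrightarrow> y \<in> A \<Longrightarrow> x < y \<Longrightarrow> split_level x y \<in> split_levels A"
  by (auto simp: split_levels_def)

lemma split_levels_mono: "A \<subseteq> B \<Longrightarrow> split_levels A \<subseteq> split_levels B"
  by (auto simp: split_levels_def)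

lemma split_levels_subset: "A \<subseteq> {..<2 ^ N} \<Longrightarrow> split_levels A \<subseteq> {..<N}"
  using split_level_less by (fastforce simp: split_levels_def)

text \<open>By \<open>split_level_max\<close> a new maximum \<open>z\<close> creates at most one new
  level, the one with the previous maximum \<open>y\<close>; its levels with smaller elements are
  this one or old ones.\<close>

lemma finite_card_split_levels:
  assumes "finite A" "A \<noteq> {}"
  shows "finite (split_levels A) \<and> Suc (card (split_levels A)) \<le> card A"
  using assms
proof (induction A rule: finite_linorder_max_induct)
  case empty
  then show ?case by simp
next
  case (insert z A)
  show ?case
  proof (cases "A = {}")
    case True
    then show ?thesis by (simp add: split_levels_def)
  next
    case False
    define y where "y = Max A"
    have y: "y \<in> A" "\<And>x. x \<in> A \<Longrightarrow> x \<le> y"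
      using insert.hyps False by (auto simp: y_def)
    have "split_levels (insert z A) \<subseteq> insert (split_level y z) (split_levels A)"
    proof
      fix l assume "l \<in> split_levels (insert z A)"
      then obtain u v where uv: "l = split_level u v" "u \<in> insert z A" "v \<in> insert z A" "u < v"
        by (auto simp: split_levels_def)
      have "u \<in> A"
        using uv insert.hyps by fastforce
      show "l \<in> insert (split_level y z) (split_levels A)"
      proof (cases "v = z \<and> u \<noteq> y")
        case True
        then have "u < y" "y < z" "l = split_level u z"
          using y \<open>u \<in> A\<close> insert.hyps uv by (auto simp: le_less)
        then have "l = max (split_level u y) (split_level y z)"
          using split_level_max by simp
        then show ?thesis
          using split_levelsI[OF \<open>u \<in> A\<close> y(1) \<open>u < y\<close>] by (auto simp: max_def)
      next
        case False
        then show ?thesis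
          using uv \<open>u \<in> A\<close> by (auto intro: split_levelsI)
      qed
    qed
    moreover have IH: "finite (split_levels A)" "Suc (card (split_levels A)) \<le> card A"
      using insert.IH False by auto
    ultimately have "finite (split_levels (insert z A))"
      "card (split_levels (insert z A)) \<le> card (insert (split_level y z) (split_levels A))"
      by (auto intro: finite_subset card_mono)
    moreover have "card (insert (split_level y z) (split_levels A)) \<le> Suc (card (split_levels A))"
      using IH(1) by (simp add: card_insert_if)
    moreover have "card (insert z A) = Suc (card A)"
      using insert.hyps by auto
    ultimately show ?thesis
      using IH by simp
  qed
qed

section \<open>Combs and full binary trees\<close>

definition inc_comb :: "nat set \<Rightarrow> bool" where
  "inc_comb A \<longleftrightarrow>
     (\<forall>x\<in>A. \<forall>y\<in>A. \<forall>z\<in>A. x < y \<longrightarrow> y < z \<longrightarrow> split_level x y < split_level y z)"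

definition dec_comb :: "nat set \<Rightarrow> bool" where
  "dec_comb A \<longleftrightarrow>
     (\<forall>x\<in>A. \<forall>y\<in>A. \<forall>z\<in>A. x < y \<longrightarrow> y < z \<longrightarrow> split_level y z < split_level x y)"

text \<open>Models the two subtrees at a branching point. Levels inside a side are compared with
  levels across only, never with those inside the other side.\<close>

definition separated :: "nat set \<Rightarrow> nat set \<Rightarrow> bool" where
  "separated B C \<longleftrightarrow> (\<forall>b\<in>B. \<forall>c\<in>C. b < c \<and>
     (\<forall>x\<in>B. \<forall>y\<in>B. x < y \<longrightarrow> split_level x y < split_level b c) \<and>
     (\<forall>x\<in>C. \<forall>y\<in>C. x < y \<longrightarrow> split_level x y < split_level b c))"

text \<open>Branching points at the same depth may have different levels; only the shape is
  prescribed, and similarity preserves it.\<close>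

primrec full_tree :: "nat \<Rightarrow> nat set \<Rightarrow> bool" where
  "full_tree 0 A \<longleftrightarrow> (\<exists>x. A = {x})"
| "full_tree (Suc d) A \<longleftrightarrow>
     (\<exists>B C. A = B \<union> C \<and> full_tree d B \<and> full_tree d C \<and> separated B C)"

lemma comb_subset:
  "inc_comb A \<Longrightarrow> B \<subseteq> A \<Longrightarrow> inc_comb B"
  "dec_comb A \<Longrightarrow> B \<subseteq> A \<Longrightarrow> dec_comb B"
  unfolding inc_comb_def dec_comb_def by blast+

lemma card_le_2I:
  assumes "finite A" "\<And>x y z::nat. x \<in> A \<Longrightarrow> y \<in> A \<Longrightarrow> z \<in> A \<Longrightarrow> x < y \<Longrightarrow> y < z \<Longrightarrow> False"
  shows "card A \<le> 2"
proof (cases "A = {}")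
  case False
  have "A \<subseteq> {Min A, Max A}"
  proof
    fix x assume "x \<in> A"
    then have "Min A \<in> A" "Max A \<in> A" "Min A \<le> x" "x \<le> Max A"
      using assms(1) False by auto
    then show "x \<in> {Min A, Max A}"
      using assms(2)[of "Min A" x "Max A"] \<open>x \<in> A\<close> by (auto simp: le_less)
  qed
  then have "card A \<le> card {Min A, Max A}"
    by (intro card_mono) auto
  also have "\<dots> \<le> 2"
    by (simp add: card_insert_if)
  finally show ?thesis .
qed simp

lemma card_inc_Int_dec:
  assumes "finite I" "inc_comb I" "dec_comb J"
  shows "card (I \<inter> J) \<le> 2"
proof (rule card_le_2I)
  fix x y z assume "x \<in> I \<inter> J" "y \<in> I \<inter> J" "z \<in> I \<inter> J" "x < y" "y < z"
  then have "split_level x y < split_level y z" "split_level y z < split_level x y"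
    using assms unfolding inc_comb_def dec_comb_def by blast+
  then show False by simp
qed (use assms in simp)

lemma separated_disjoint: "separated B C \<Longrightarrow> B \<inter> C = {}"
  unfolding separated_def by blast

lemma separated_subset:
  assumes "separated B C" "B' \<subseteq> B" "C' \<subseteq> C"
  shows "separated B' C'"
  using assms(1) subsetD[OF assms(2)] subsetD[OF assms(3)] unfolding separated_def by simp

lemma inc_comb_insert:
  assumes "separated B C" "I \<subseteq> B" "inc_comb I" "c \<in> C"
  shows "inc_comb (insert c I)"
proof -
  have *: "x < c" if "x \<in> I" for x
    using assms that unfolding separated_def by blast
  show ?thesis
    unfolding inc_comb_def
  proof (intro ballI impI)
    fix x y z
    assume xyz: "x \<in> insert c I" "y \<in> insert c I" "z \<in> insert c I" "x < y" "y < z"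
    then have "x \<in> I" "y \<in> I"
      using *[of z] *[of y] by auto
    then show "split_level x y < split_level y z"
      using xyz assms unfolding inc_comb_def separated_def by (cases "z = c") blast+
  qed
qed

lemma dec_comb_insert:
  assumes "separated B C" "J \<subseteq> C" "dec_comb J" "b \<in> B"
  shows "dec_comb (insert b J)"
proof -
  have *: "b < x" if "x \<in> J" for x
    using assms that unfolding separated_def by blast
  show ?thesis
    unfolding dec_comb_def
  proof (intro ballI impI)
    fix x y z
    assume xyz: "x \<in> insert b J" "y \<in> insert b J" "z \<in> insert b J" "x < y" "y < z"
    then have "z \<in> J" "y \<in> J"
      using *[of x] *[of y] by auto
    then show "split_level y z < split_level x y"
      using xyz assms unfolding dec_comb_def separated_def by (cases "x = b") blast+
  qed
qed

section \<open>Combs inside full binary trees\<close>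

lemma full_tree_card: "full_tree d P \<Longrightarrow> finite P \<and> card P = 2 ^ d"
proof (induction d arbitrary: P)
  case (Suc d)
  then obtain B C where "P = B \<union> C" "full_tree d B" "full_tree d C" "separated B C"
    by auto
  with Suc.IH[of B] Suc.IH[of C] show ?case
    by (simp add: card_Un_disjoint separated_disjoint)
qed auto

lemma full_tree_nonempty: "full_tree d P \<Longrightarrow> P \<noteq> {}"
  using full_tree_card by fastforce

lemma full_tree_subtree: "full_tree d P \<Longrightarrow> e \<le> d \<Longrightarrow> \<exists>P'\<subseteq>P. full_tree e P'"
proof (induction d arbitrary: P)
  case (Suc d)
  show ?case
  proof (cases "e = Suc d")
    case False
    with Suc.prems obtain B C where "P = B \<union> C" "full_tree d B" "e \<le> d"
      by auto
    then show ?thesis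
      using Suc.IH by blast
  qed (use Suc.prems in blast)
qed auto

text \<open>Descend into the left subtree and take one leaf from the right one; every depth adds one
  tooth to the comb.\<close>

lemma full_tree_inc_comb: "full_tree d P \<Longrightarrow> \<exists>I\<subseteq>P. inc_comb I \<and> card I = Suc d"
proof (induction d arbitrary: P)
  case 0
  then show ?case by (auto simp: inc_comb_def)
next
  case (Suc d)
  then obtain B C where BC: "P = B \<union> C" "full_tree d B" "full_tree d C" "separated B C"
    by auto
  then obtain I c where I: "I \<subseteq> B" "inc_comb I" "card I = Suc d" and c: "c \<in> C"
    using Suc.IH full_tree_nonempty by blast
  have "finite I" "c \<notin> I"
    using I c separated_disjoint[OF BC(4)] by (auto intro: card_ge_0_finite)
  then have "card (insert c I) = Suc (Suc d)"
    using I by simp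
  then show ?case
    using inc_comb_insert[OF BC(4) I(1,2) c] BC(1) I(1) c by (intro exI[of _ "insert c I"]) auto
qed

text \<open>Mirror image: descend into the right subtree and take one leaf from the left
  one.\<close>

lemma full_tree_dec_comb: "full_tree d P \<Longrightarrow> \<exists>J\<subseteq>P. dec_comb J \<and> card J = Suc d"
proof (induction d arbitrary: P)
  case 0
  then show ?case by (auto simp: dec_comb_def)
next
  case (Suc d)
  then obtain B C where BC: "P = B \<union> C" "full_tree d B" "full_tree d C" "separated B C"
    by auto
  then obtain J b where J: "J \<subseteq> C" "dec_comb J" "card J = Suc d" and b: "b \<in> B"
    using Suc.IH full_tree_nonempty by blast
  have "finite J" "b \<notin> J"
    using J b separated_disjoint[OF BC(4)] by (auto intro: card_ge_0_finite)
  then have "card (insert b J) = Suc (Suc d)"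
    using J by simp
  then show ?case
    using dec_comb_insert[OF BC(4) J(1,2) b] BC(1) J(1) b by (intro exI[of _ "insert b J"]) auto
qed

lemma card_le_1I:
  assumes "\<And>x y::nat. x \<in> A \<Longrightarrow> y \<in> A \<Longrightarrow> x < y \<Longrightarrow> False"
  shows "card A \<le> 1"
proof (cases "A = {}")
  case False
  then obtain a where "a \<in> A" by blast
  then have "A \<subseteq> {a}"
    using assms[of a] assms[of _ a] by (auto intro: linorder_neqE_nat)
  then show ?thesis
    using card_mono[of "{a}" A] by simp
qed simp

text \<open>A comb meeting both subtrees has at most one point in one of them: two points there and
  one on the other side would have levels ordered against the comb. So each depth adds at most one
  point.\<close>

lemma full_tree_card_comb:
  "full_tree d P \<Longrightarrow> I \<subseteq> P \<Longrightarrow> inc_comb I \<or> dec_comb I \<Longrightarrow> card I \<le> Suc d"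
proof (induction d arbitrary: P I)
  case 0
  then show ?case
    using card_mono[of P I] by auto
next
  case (Suc d)
  then obtain B C where BC: "P = B \<union> C" "full_tree d B" "full_tree d C" "separated B C"
    by auto
  have I: "I = (I \<inter> B) \<union> (I \<inter> C)"
    using Suc.prems BC by blast
  have "inc_comb (I \<inter> X) \<or> dec_comb (I \<inter> X)" for X
    using Suc.prems(3) comb_subset by (meson Int_lower1)
  then have IH: "card (I \<inter> B) \<le> Suc d" "card (I \<inter> C) \<le> Suc d"
    using Suc.IH BC by (meson Int_lower2)+
  have "card (I \<inter> B) \<le> 1 \<or> card (I \<inter> C) = 0"  if "dec_comb I"
  proof (cases "I \<inter> C = {}")
    case False
    then obtain c where c: "c \<in> I" "c \<in> C" by blast
    have "card (I \<inter> B) \<le> 1"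
    proof (rule card_le_1I)
      fix x y assume "x \<in> I \<inter> B" "y \<in> I \<inter> B" "x < y"
      then have "y < c" "split_level x y < split_level y c" "split_level y c < split_level x y"
        using that c BC(4) unfolding dec_comb_def separated_def by blast+
      then show False by simp
    qed
    then show ?thesis ..
  qed simp
  moreover have "card (I \<inter> C) \<le> 1 \<or> card (I \<inter> B) = 0"  if "inc_comb I"
  proof (cases "I \<inter> B = {}")
    case False
    then obtain b where b: "b \<in> I" "b \<in> B" by blast
    have "card (I \<inter> C) \<le> 1"
    proof (rule card_le_1I)
      fix x y assume "x \<in> I \<inter> C" "y \<in> I \<inter> C" "x < y"
      then have "b < x" "split_level x y < split_level b x" "split_level b x < split_level x y"
        using that b BC(4) unfolding inc_comb_def separated_def by blast+
      then show False by simp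
    qed
    then show ?thesis ..
  qed simp
  moreover have "card I \<le> card (I \<inter> B) + card (I \<inter> C)"
    by (subst I) (rule card_Un_le)
  ultimately show ?case
    using IH Suc.prems(3) by linarith
qed

text \<open>The combs share at most two points, so together they leave little of \<open>Q\<close>
  free. The tree has at most \<open>d + 1\<close> points on each comb and must place all others in
  the free part.\<close>

lemma full_tree_with_combs_bound:
  assumes "finite Q" "I \<subseteq> Q" "inc_comb I" "J \<subseteq> Q" "dec_comb J" "P \<subseteq> Q" "full_tree d P"
  shows "2 ^ d + card I + card J \<le> card Q + 2 * d + 4"
proof -
  have fin: "finite I" "finite J" "finite P"
    using assms finite_subset by blast+
  have "card (I \<union> J) + card (I \<inter> J) = card I + card J"
    using card_Un_Int fin by metis
  then have 1: "card I + card J \<le> card (I \<union> J) + 2"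
    using card_inc_Int_dec[of I J] fin assms by linarith
  have 2: "card (Q - (I \<union> J)) + card (I \<union> J) = card Q"
    using assms fin by (simp add: card_Diff_subset card_mono)
  have "P \<subseteq> (P \<inter> I) \<union> (P \<inter> J) \<union> (Q - (I \<union> J))"
    using assms by blast
  then have "card P \<le> card ((P \<inter> I) \<union> (P \<inter> J) \<union> (Q - (I \<union> J)))"
    using fin assms(1) by (intro card_mono) auto
  also have "\<dots> \<le> card (P \<inter> I) + card (P \<inter> J) + card (Q - (I \<union> J))"
    by (meson add_le_mono card_Un_le le_refl order.trans)
  also have "\<dots> \<le> Suc d + Suc d + card (Q - (I \<union> J))"
    using full_tree_card_comb[OF assms(7)] comb_subset assms(3,5)
    by (intro add_mono) auto
  finally show ?thesis
    using 1 2 full_tree_card[OF assms(7)] by simp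
qed

section \<open>Large sets contain a long comb or a deep full tree\<close>

text \<open>Cut at the topmost branching point, whose level \<open>L\<close> is that of the minimum
  and the maximum: \<open>B\<close> collects the elements that split from the minimum below
  \<open>L\<close>.\<close>

lemma separated_split:
  assumes "finite S" "2 \<le> card S"
  obtains B C where "S = B \<union> C" "B \<noteq> {}" "C \<noteq> {}" "separated B C"
proof -
  have ne: "S \<noteq> {}" using assms by auto
  define m where "m = Min S"
  define M where "M = Max S"
  define L where "L = split_level m M"
  define B where "B = {x \<in> S. x = m \<or> split_level m x < L}"
  define C where "C = S - B"
  have m: "m \<in> S" "\<And>x. x \<in> S \<Longrightarrow> m \<le> x" and M: "M \<in> S" "\<And>x. x \<in> S \<Longrightarrow> x \<le> M"
    using ne assms by (auto simp: m_def M_def)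
  have "m \<noteq> M"
  proof
    assume "m = M"
    then have "S \<subseteq> {m}" using m M by force
    then show False using assms card_mono[of "{m}" S] by simp
  qed
  then have "M \<in> C"
    using M by (auto simp: C_def B_def L_def)
  have C: "m < c" "split_level m c = L" if "c \<in> C" for c
  proof -
    have c: "c \<in> S" "c \<noteq> m" "\<not> split_level m c < L"
      using that by (auto simp: C_def B_def)
    then show "m < c" using m by (simp add: le_neq_implies_less)
    show "split_level m c = L"
    proof (cases "c = M")
      case False
      then have "L = max (split_level m c) (split_level c M)"
        unfolding L_def using c \<open>m < c\<close> M by (intro split_level_max) (auto simp: le_less)
      then show ?thesis using c by simp
    qed (simp add: L_def)
  qed
  have mB: "m < b \<Longrightarrow> split_level m b < L" "m \<le> b" if "b \<in> B" for b
    using that m by (auto simp: B_def)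
  have less: "b < c" if "b \<in> B" "c \<in> C" for b c
  proof (rule ccontr)
    assume "\<not> b < c"
    moreover have "b \<noteq> c" using that by (auto simp: C_def)
    ultimately have "c < b" by simp
    then show False
      using split_level_max[OF C(1)[OF that(2)], of b] C[OF that(2)] mB[OF that(1)] by simp
  qed
  have BC: "split_level b c = L" if "b \<in> B" "c \<in> C" for b c
  proof (cases "b = m")
    case False
    then have "m < b" using mB that by (simp add: le_neq_implies_less)
    then show ?thesis
      using split_level_max[OF _ less[OF that], of m] mB(1)[OF that(1)] C(2)[OF that(2)] by auto
  qed (use C that in simp)
  have BB: "split_level x y < L" if "x \<in> B" "y \<in> B" "x < y" for x y
  proof (cases "x = m")
    case False
    then have "m < x" using mB that by (simp add: le_neq_implies_less)
    then show ?thesis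
      using split_level_max[of m x y] mB(1)[OF that(2)] that by auto
  qed (use mB that in auto)
  \<comment> \<open>Both \<open>x\<close> and \<open>y\<close> split from \<open>m\<close> at level
    \<open>L\<close>, so their own level is at most \<open>L\<close>, and equality would repeat a
    level along \<open>m < x < y\<close>.\<close>
  have CC: "split_level x y < L" if "x \<in> C" "y \<in> C" "x < y" for x y
    using split_level_max[of m x y] split_level_neq[of m x y] C[OF that(1)] C[OF that(2)] that
    by auto
  have "separated B C"
    unfolding separated_def using less BC BB CC by simp
  moreover have "S = B \<union> C" "B \<noteq> {}" "C \<noteq> {}"
    using m(1) \<open>M \<in> C\<close> by (auto simp: C_def B_def)
  ultimately show thesis using that by blast
qed

text \<open>Induction over the topmost split. A point of the other side prolongs increasing combs in
  \<open>B\<close> and decreasing combs in \<open>C\<close>, so these are shorter by one than in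
  \<open>S\<close>. One side contains no full tree of depth \<open>d - 1\<close>, since two of them
  would form one of depth \<open>d\<close>.\<close>

lemma card_le_if_no_comb_or_full_tree:
  assumes "finite S"
    and "\<And>I. I \<subseteq> S \<Longrightarrow> inc_comb I \<Longrightarrow> card I < a"
    and "\<And>J. J \<subseteq> S \<Longrightarrow> dec_comb J \<Longrightarrow> card J < b"
    and "\<And>P. P \<subseteq> S \<Longrightarrow> \<not> full_tree d P"
  shows "card S \<le> (a + b) ^ d"
  using assms
proof (induction S arbitrary: a b d rule: finite_psubset_induct)
  case (psubset S)
  have "inc_comb {}" "dec_comb {}"
    by (auto simp: inc_comb_def dec_comb_def)
  then have "0 < a" "0 < b"
    using psubset.prems(1,2)[of "{}"] by auto
  then obtain a' b' where ab: "a = Suc a'" "b = Suc b'"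
    by (meson gr0_implies_Suc)
  \<comment> \<open>This is \<open>a + b - 1\<close>, the sum of the two comb bounds on either side:
    one of them drops in \<open>B\<close>, the other in \<open>C\<close>.\<close>
  define m where "m = a' + Suc b'"
  show ?case
  proof (cases "2 \<le> card S")
    case False
    have "Suc 0 \<le> (a + b) ^ d"
      using \<open>0 < a\<close> by (simp add: Suc_le_eq)
    then show ?thesis using False by linarith
  next
    case True
    obtain B C where BC: "S = B \<union> C" "B \<noteq> {}" "C \<noteq> {}" "separated B C"
      using separated_split[OF psubset.hyps True] by blast
    have sub: "B \<subset> S" "C \<subset> S"
      using BC separated_disjoint[OF BC(4)] by auto
    obtain x where x: "x \<in> B" using BC by blast
    obtain y where y: "y \<in> C" using BC by blast
    have "d \<noteq> 0"
      using psubset.prems(3)[of "{x}"] x BC by (auto intro: ccontr)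
    then obtain d' where d: "d = Suc d'"
      using not0_implies_Suc by blast
    have fin: "finite X" if "X \<subseteq> S" for X
      using that psubset.hyps finite_subset by blast
    have B1: "card I < a'" if "I \<subseteq> B" "inc_comb I" for I
    proof -
      have "y \<notin> I" using that y separated_disjoint[OF BC(4)] by blast
      then have "card (insert y I) = Suc (card I)"
        using that fin sub by (metis card_insert_disjoint order.trans psubset_imp_subset)
      moreover have "card (insert y I) < a"
        using inc_comb_insert[OF BC(4) that y] that y BC by (intro psubset.prems(1)) auto
      ultimately show ?thesis by (simp add: ab)
    qed
    have C1: "card J < b'" if "J \<subseteq> C" "dec_comb J" for J
    proof -
      have "x \<notin> J" using that x separated_disjoint[OF BC(4)] by blast
      then have "card (insert x J) = Suc (card J)"
        using that fin sub by (metis card_insert_disjoint order.trans psubset_imp_subset)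
      moreover have "card (insert x J) < b"
        using dec_comb_insert[OF BC(4) that x] that x BC by (intro psubset.prems(2)) auto
      ultimately show ?thesis by (simp add: ab)
    qed
    have B: "card B \<le> m ^ e" if "\<And>P. P \<subseteq> B \<Longrightarrow> \<not> full_tree e P" for e
      using psubset.IH[OF sub(1), of a' b e] B1 psubset.prems(2) that sub(1)
      by (auto simp: m_def ab)
    have C: "card C \<le> m ^ e" if "\<And>P. P \<subseteq> C \<Longrightarrow> \<not> full_tree e P" for e
      using psubset.IH[OF sub(2), of a b' e] C1 psubset.prems(1) that sub(2)
      by (auto simp: m_def ab)
    have "(\<forall>P. P \<subseteq> B \<longrightarrow> \<not> full_tree d' P) \<or> (\<forall>P. P \<subseteq> C \<longrightarrow> \<not> full_tree d' P)"
    proof (rule ccontr)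
      assume "\<not> ?thesis"
      then obtain P P' where P: "P \<subseteq> B" "full_tree d' P" "P' \<subseteq> C" "full_tree d' P'" by blast
      then have "separated P P'"
        using separated_subset[OF BC(4)] by blast
      then have "full_tree d (P \<union> P')"
        using P by (auto simp: d)
      moreover have "P \<union> P' \<subseteq> S" using P BC by blast
      ultimately show False using psubset.prems(3) by blast
    qed
    moreover have "card B \<le> m ^ d" "card C \<le> m ^ d"
      using B[of d] C[of d] psubset.prems(3) sub by blast+
    ultimately have "card B + card C \<le> m ^ d' + m ^ d"
      using B[of d'] C[of d'] by fastforce
    also have "\<dots> = Suc m * m ^ d'"
      by (simp add: d)
    also have "\<dots> \<le> Suc m * Suc m ^ d'"
      by (intro mult_left_mono power_mono) auto
    also have "\<dots> = (a + b) ^ d"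
      by (simp add: d ab m_def)
    finally show ?thesis
      using card_Un_le[of B C] BC(1) by simp
  qed
qed

text \<open>In an increasing comb the level of a pair depends only on its larger element.\<close>

lemma inc_comb_split_levels:
  assumes "finite C" "C \<noteq> {}" "inc_comb C"
  shows "card C = Suc (card (split_levels C))"
    and "X \<subseteq> split_levels C \<Longrightarrow> \<exists>Y\<subseteq>C. card Y = Suc (card X) \<and> split_levels Y = X"
proof -
  define m where "m = Min C"
  have m: "m \<in> C" "\<And>y. y \<in> C - {m} \<Longrightarrow> m < y"
    using assms by (auto simp: m_def order.not_eq_order_implies_strict)
  have lev: "split_level x y = split_level m y" if "x \<in> C" "y \<in> C" "x < y" for x y
  proof (cases "x = m")
    case False
    then have "m < x" using m that by blast
    then show ?thesis
      using split_level_max[of m x y] that assms(3) m(1) unfolding inc_comb_def by fastforce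
  qed simp
  have inj: "inj_on (split_level m) (C - {m})"
  proof (rule linorder_inj_onI)
    fix x y assume "x < y" "x \<in> C - {m}" "y \<in> C - {m}"
    then show "split_level m x \<noteq> split_level m y"
      using lev[of x y] assms(3) m unfolding inc_comb_def
      by (metis Diff_iff order.irrefl)
  qed auto
  have levels: "split_levels (insert m Y) = split_level m ` Y" if "Y \<subseteq> C - {m}" for Y
  proof
    show "split_levels (insert m Y) \<subseteq> split_level m ` Y"
    proof
      fix l assume "l \<in> split_levels (insert m Y)"
      then obtain x y where xy: "l = split_level x y" "x \<in> insert m Y" "y \<in> insert m Y" "x < y"
        by (auto simp: split_levels_def)
      have "x \<in> C" "y \<in> C" using xy that m by auto
      moreover have "y \<in> Y" using xy that m(2) by fastforce
      ultimately show "l \<in> split_level m ` Y"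
        using lev[of x y] xy by auto
    qed
    show "split_level m ` Y \<subseteq> split_levels (insert m Y)"
      using m(2) that by (auto intro!: split_levelsI)
  qed
  have C: "split_levels C = split_level m ` (C - {m})"
    using levels[of "C - {m}"] m(1) by (simp add: insert_absorb)
  show "card C = Suc (card (split_levels C))"
    unfolding C card_image[OF inj] using assms m(1) by (simp only: card_Suc_Diff1)
  show "\<exists>Y\<subseteq>C. card Y = Suc (card X) \<and> split_levels Y = X" if X: "X \<subseteq> split_levels C"
  proof -
    obtain Y where Y: "Y \<subseteq> C - {m}" "X = split_level m ` Y"
      using X unfolding C by (meson subset_imageE)
    have "finite Y" "m \<notin> Y"
      using Y assms finite_subset by blast+
    then have "card (insert m Y) = Suc (card X)"
      using Y inj by (simp add: card_image inj_on_subset)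
    then show ?thesis
      using levels[OF Y(1)] Y m(1) by (intro exI[of _ "insert m Y"]) auto
  qed
qed

text \<open>Mirror image of the previous lemma, with the maximum as reference point: in a decreasing
  comb the level of a pair depends only on its smaller element.\<close>

lemma dec_comb_split_levels:
  assumes "finite C" "C \<noteq> {}" "dec_comb C"
  shows "card C = Suc (card (split_levels C))"
    and "X \<subseteq> split_levels C \<Longrightarrow> \<exists>Y\<subseteq>C. card Y = Suc (card X) \<and> split_levels Y = X"
proof -
  define m where "m = Max C"
  have m: "m \<in> C" "\<And>y. y \<in> C - {m} \<Longrightarrow> y < m"
    using assms by (auto simp: m_def order.not_eq_order_implies_strict)
  have lev: "split_level x y = split_level x m" if "x \<in> C" "y \<in> C" "x < y" for x y
  proof (cases "y = m")
    case False
    then have "y < m" using m that by blast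
    then show ?thesis
      using split_level_max[of x y m] that assms(3) m(1) unfolding dec_comb_def by fastforce
  qed simp
  have inj: "inj_on (\<lambda>x. split_level x m) (C - {m})"
  proof (rule linorder_inj_onI)
    fix x y assume "x < y" "x \<in> C - {m}" "y \<in> C - {m}"
    then show "split_level x m \<noteq> split_level y m"
      using lev[of x y] assms(3) m unfolding dec_comb_def
      by (metis Diff_iff order.irrefl)
  qed auto
  have levels: "split_levels (insert m Y) = (\<lambda>x. split_level x m) ` Y" if "Y \<subseteq> C - {m}" for Y
  proof
    show "split_levels (insert m Y) \<subseteq> (\<lambda>x. split_level x m) ` Y"
    proof
      fix l assume "l \<in> split_levels (insert m Y)"
      then obtain x y where xy: "l = split_level x y" "x \<in> insert m Y" "y \<in> insert m Y" "x < y"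
        by (auto simp: split_levels_def)
      have "x \<in> C" "y \<in> C" using xy that m by auto
      moreover have "x \<in> Y" using xy that m(2) by fastforce
      ultimately show "l \<in> (\<lambda>x. split_level x m) ` Y"
        using lev[of x y] xy by auto
    qed
    show "(\<lambda>x. split_level x m) ` Y \<subseteq> split_levels (insert m Y)"
      using m(2) that by (auto intro!: split_levelsI)
  qed
  have C: "split_levels C = (\<lambda>x. split_level x m) ` (C - {m})"
    using levels[of "C - {m}"] m(1) by (simp add: insert_absorb)
  show "card C = Suc (card (split_levels C))"
    unfolding C card_image[OF inj] using assms m(1) by (simp only: card_Suc_Diff1)
  show "\<exists>Y\<subseteq>C. card Y = Suc (card X) \<and> split_levels Y = X" if X: "X \<subseteq> split_levels C"
  proof -
    obtain Y where Y: "Y \<subseteq> C - {m}" "X = (\<lambda>x. split_level x m) ` Y"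
      using X unfolding C by (meson subset_imageE)
    have "finite Y" "m \<notin> Y"
      using Y assms finite_subset by blast+
    then have "card (insert m Y) = Suc (card X)"
      using Y inj by (simp add: card_image inj_on_subset)
    then show ?thesis
      using levels[OF Y(1)] Y m(1) by (intro exI[of _ "insert m Y"]) auto
  qed
qed

section \<open>Similarity of finite sets\<close>

text \<open>The induced map \<open>\<psi>\<close> makes the branching structure invariant, including
  comparisons of levels of unrelated pairs. The recursion on \<open>\<psi>\<close> demands the same
  of the levels themselves, \<open>h\<close> times in all.\<close>

primrec similar :: "nat \<Rightarrow> (nat \<Rightarrow> nat) \<Rightarrow> nat set \<Rightarrow> bool" where
  "similar 0 \<phi> A \<longleftrightarrow> strict_mono_on A \<phi>"
| "similar (Suc h) \<phi> A \<longleftrightarrow> strict_mono_on A \<phi> \<and>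
     (\<exists>\<psi>. (\<forall>x\<in>A. \<forall>y\<in>A. x < y \<longrightarrow> split_level (\<phi> x) (\<phi> y) = \<psi> (split_level x y)) \<and>
          similar h \<psi> (split_levels A))"

lemma similar_strict_mono_on: "similar h \<phi> A \<Longrightarrow> strict_mono_on A \<phi>"
  by (cases h) auto

lemma similar_subset: "similar h \<phi> A \<Longrightarrow> B \<subseteq> A \<Longrightarrow> similar h \<phi> B"
proof (induction h arbitrary: \<phi> A B)
  case 0
  then show ?case by (simp add: monotone_on_subset)
next
  case (Suc h)
  then obtain \<psi> where \<psi>: "similar h \<psi> (split_levels A)"
    "\<And>x y. x \<in> A \<Longrightarrow> y \<in> A \<Longrightarrow> x < y \<Longrightarrow> split_level (\<phi> x) (\<phi> y) = \<psi> (split_level x y)"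
    by auto
  have "similar h \<psi> (split_levels B)"
    using Suc.IH[OF \<psi>(1)] split_levels_mono[OF Suc.prems(2)] by blast
  then show ?case
    using Suc.prems \<psi>(2) by (auto simp: subset_iff intro: monotone_on_subset)
qed

text \<open>The induced map on levels is strictly increasing. This is what carries combs, separation
  and full trees over to the image.\<close>

lemma similar_Suc_less:
  assumes "similar (Suc h) \<phi> A" "x \<in> A" "y \<in> A" "x < y" "u \<in> A" "v \<in> A" "u < v"
    "split_level x y < split_level u v"
  shows "split_level (\<phi> x) (\<phi> y) < split_level (\<phi> u) (\<phi> v)"
proof -
  obtain \<psi> where \<psi>: "similar h \<psi> (split_levels A)"
    "\<And>x y. x \<in> A \<Longrightarrow> y \<in> A \<Longrightarrow> x < y \<Longrightarrow> split_level (\<phi> x) (\<phi> y) = \<psi> (split_level x y)"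
    using assms(1) by auto
  then show ?thesis
    using strict_mono_onD[OF similar_strict_mono_on[OF \<psi>(1)]] assms by (simp add: split_levelsI)
qed

lemma similar_Suc_image:
  assumes "similar (Suc h) \<phi> A"
  obtains \<psi> where "similar h \<psi> (split_levels A)" "\<psi> ` split_levels A \<subseteq> split_levels (\<phi> ` A)"
proof -
  obtain \<psi> where \<psi>: "similar h \<psi> (split_levels A)"
    "\<And>x y. x \<in> A \<Longrightarrow> y \<in> A \<Longrightarrow> x < y \<Longrightarrow> split_level (\<phi> x) (\<phi> y) = \<psi> (split_level x y)"
    using assms by auto
  moreover have "\<psi> ` split_levels A \<subseteq> split_levels (\<phi> ` A)"
  proof
    fix l assume "l \<in> \<psi> ` split_levels A"
    then obtain x y where "x \<in> A" "y \<in> A" "x < y" "l = \<psi> (split_level x y)"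
      by (auto simp: split_levels_def)
    then show "l \<in> split_levels (\<phi> ` A)"
      using \<psi>(2)[of x y] strict_mono_onD[OF similar_strict_mono_on[OF assms], of x y]
        split_levelsI[of "\<phi> x" "\<phi> ` A" "\<phi> y"] by simp
  qed
  ultimately show thesis using that by blast
qed

lemma similar_Suc_comb:
  assumes "similar (Suc h) \<phi> A"
  shows "inc_comb A \<Longrightarrow> inc_comb (\<phi> ` A)" "dec_comb A \<Longrightarrow> dec_comb (\<phi> ` A)"
proof -
  have less: "\<phi> x < \<phi> y \<longleftrightarrow> x < y" if "x \<in> A" "y \<in> A" for x y
    using strict_mono_on_less[OF similar_strict_mono_on[OF assms] that] .
  show "inc_comb (\<phi> ` A)" if "inc_comb A"
    using that unfolding inc_comb_def by (auto simp: less intro: similar_Suc_less[OF assms])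
  show "dec_comb (\<phi> ` A)" if "dec_comb A"
    using that unfolding dec_comb_def by (auto simp: less intro: similar_Suc_less[OF assms])
qed

lemma similar_Suc_separated:
  assumes "similar (Suc h) \<phi> A" "B \<subseteq> A" "C \<subseteq> A" "separated B C"
  shows "separated (\<phi> ` B) (\<phi> ` C)"
proof -
  have less: "x < y" if "x \<in> A" "y \<in> A" "\<phi> x < \<phi> y" for x y
    using strict_mono_on_less[OF similar_strict_mono_on[OF assms(1)]] that by simp
  have 1: "\<phi> b < \<phi> c" if "b \<in> B" "c \<in> C" for b c
    using strict_mono_onD[OF similar_strict_mono_on[OF assms(1)]] assms that
    unfolding separated_def by blast
  have 2: "split_level (\<phi> x) (\<phi> y) < split_level (\<phi> b) (\<phi> c)"
    if "b \<in> B" "c \<in> C" "\<phi> x < \<phi> y" "x \<in> B \<and> y \<in> B \<or> x \<in> C \<and> y \<in> C" for b c x y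
  proof -
    have A: "b \<in> A" "c \<in> A" "x \<in> A" "y \<in> A"
      using that assms(2,3) by auto
    then have "x < y" using less that by blast
    then have "b < c" "split_level x y < split_level b c"
      using assms(4) that unfolding separated_def by blast+
    then show ?thesis
      using A \<open>x < y\<close> by (intro similar_Suc_less[OF assms(1)])
  qed
  show ?thesis
    unfolding separated_def using 1 2 by blast
qed

lemma similar_Suc_full_tree:
  "similar (Suc h) \<phi> A \<Longrightarrow> full_tree d A \<Longrightarrow> full_tree d (\<phi> ` A)"
proof (induction d arbitrary: A)
  case (Suc d)
  then obtain B C where BC: "A = B \<union> C" "full_tree d B" "full_tree d C" "separated B C"
    by auto
  then have "full_tree d (\<phi> ` B)" "full_tree d (\<phi> ` C)"
    using Suc.IH similar_subset[OF Suc.prems(1)] by blast+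
  moreover have "separated (\<phi> ` B) (\<phi> ` C)"
    using similar_Suc_separated[OF Suc.prems(1)] BC by blast
  ultimately show ?case
    using BC(1) by (auto simp: image_Un)
qed auto

section \<open>Sets whose small subsets are all similar to subsets of one set\<close>

text \<open>One step is \<open>card_le_if_no_comb_or_full_tree\<close> with depth \<open>K\<close>
  and both comb sizes below \<open>similar_bound K h N + 2\<close>: a comb has one element more than
  it has levels.\<close>

primrec similar_bound :: "nat \<Rightarrow> nat \<Rightarrow> nat \<Rightarrow> nat" where
  "similar_bound K 0 N = N"
| "similar_bound K (Suc h) N = (2 * (similar_bound K h N + 2)) ^ K"

text \<open>
  Each step down replaces \<open>S\<close> by the levels of a large comb in \<open>S\<close>; this decreases both \<open>s\<close> and
  \<open>card Q\<close> by one, so the hypotheses lose one unit per step.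
\<close>

lemma card_le_similar_bound:
  assumes "finite Q" "S \<subseteq> {..<tower (Suc h) N}"
    and "\<And>X. X \<subseteq> S \<Longrightarrow> card X \<le> s \<Longrightarrow> \<exists>\<phi>. similar h \<phi> X \<and> \<phi> ` X \<subseteq> Q"
    and "card Q + h + 2 * d + 4 \<le> 2 * s + 2 ^ d" "2 ^ d + h \<le> Suc s" "s \<le> K"
  shows "card S \<le> similar_bound K h N"
  using assms
proof (induction h arbitrary: Q S s)
  case 0
  then show ?case using card_mono[of "{..<N}" S] by simp
next
  case (Suc h)
  define u where "u = similar_bound K h N + 2"
  have "finite S"
    using Suc.prems(2) finite_subset by blast
  have d_le: "2 ^ d \<le> s"
    using Suc.prems(5) by simp
  have no_comb: "card C < u" if C: "C \<subseteq> S"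
    "card C = Suc (card (split_levels C))"
    "\<And>X. X \<subseteq> split_levels C \<Longrightarrow> \<exists>Y\<subseteq>C. card Y = Suc (card X) \<and> split_levels Y = X" for C
  proof -
    obtain x where x: "x \<in> C"
      using C(2) by fastforce
    have "1 \<le> s"
      using d_le one_le_power[of "2::nat" d] by linarith
    then have "Q \<noteq> {}"
      using Suc.prems(3)[of "{x}"] x C(1) by auto
    then have Q: "finite (split_levels Q)" "Suc (card (split_levels Q)) \<le> card Q"
      using finite_card_split_levels Suc.prems(1) by blast+
    have "card (split_levels C) \<le> similar_bound K h N"
    proof (rule Suc.IH[OF Q(1), where s = "s - 1"])
      show "split_levels C \<subseteq> {..<tower (Suc h) N}"
        using C(1) Suc.prems(2) by (intro split_levels_subset) auto
      show "\<exists>\<psi>. similar h \<psi> X \<and> \<psi> ` X \<subseteq> split_levels Q"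
        if X: "X \<subseteq> split_levels C" "card X \<le> s - 1" for X
      proof -
        \<comment> \<open>A set of levels is realised by a subset of the comb with one more element;
          this is where one unit of \<open>s\<close> is spent.\<close>
        obtain Y where Y: "Y \<subseteq> C" "card Y = Suc (card X)" "split_levels Y = X"
          using C(3) X by blast
        then obtain \<phi> where \<phi>: "similar (Suc h) \<phi> Y" "\<phi> ` Y \<subseteq> Q"
          using Suc.prems(3)[of Y] C(1) X \<open>1 \<le> s\<close> by fastforce
        obtain \<psi> where "similar h \<psi> X" "\<psi> ` X \<subseteq> split_levels (\<phi> ` Y)"
          using similar_Suc_image[OF \<phi>(1)] Y(3) by blast
        then show ?thesis
          using split_levels_mono[OF \<phi>(2)] by blast
      qed
    qed (use Q Suc.prems \<open>1 \<le> s\<close> in linarith)+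
    then show ?thesis
      using C(2) by (simp add: u_def)
  qed
  have "card S \<le> (u + u) ^ K"
  proof (rule card_le_if_no_comb_or_full_tree[OF \<open>finite S\<close>])
    show "card I < u" if "I \<subseteq> S" "inc_comb I" for I
    proof (cases "I = {}")
      case False
      have "finite I"
        using \<open>finite S\<close> that finite_subset by blast
      then show ?thesis
        using no_comb[OF that(1)] inc_comb_split_levels[OF _ False that(2)] by blast
    qed (simp add: u_def)
    show "card J < u" if "J \<subseteq> S" "dec_comb J" for J
    proof (cases "J = {}")
      case False
      have "finite J"
        using \<open>finite S\<close> that finite_subset by blast
      then show ?thesis
        using no_comb[OF that(1)] dec_comb_split_levels[OF _ False that(2)] by blast
    qed (simp add: u_def)
    show "\<not> full_tree K P" if P: "P \<subseteq> S" for P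
    proof
      \<comment> \<open>Depth \<open>K >= s\<close> supplies an increasing and a decreasing comb of
        size \<open>s\<close> and a full tree with \<open>2 ^ d <= s\<close> leaves. Each is small
        enough to be mapped into \<open>Q\<close>, possibly by different maps, but \<open>Q\<close>
        has no room for all three images.\<close>
      assume full: "full_tree K P"
      obtain I0 where I0: "I0 \<subseteq> P" "inc_comb I0" "card I0 = Suc K"
        using full_tree_inc_comb[OF full] by blast
      then obtain I where I: "I \<subseteq> I0" "card I = s"
        using obtain_subset_with_card_n[of s I0] Suc.prems(6) by auto
      obtain J0 where J0: "J0 \<subseteq> P" "dec_comb J0" "card J0 = Suc K"
        using full_tree_dec_comb[OF full] by blast
      then obtain J where J: "J \<subseteq> J0" "card J = s"
        using obtain_subset_with_card_n[of s J0] Suc.prems(6) by auto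
      have "d \<le> K"
        using less_exp[of d] d_le Suc.prems(6) by linarith
      then obtain T where T: "T \<subseteq> P" "full_tree d T"
        using full_tree_subtree[OF full] by blast
      obtain \<phi> where \<phi>: "similar (Suc h) \<phi> I" "\<phi> ` I \<subseteq> Q"
        using Suc.prems(3)[of I] I I0(1) P by (meson order.trans order.refl)
      obtain \<psi> where \<psi>: "similar (Suc h) \<psi> J" "\<psi> ` J \<subseteq> Q"
        using Suc.prems(3)[of J] J J0(1) P by (meson order.trans order.refl)
      obtain \<theta> where \<theta>: "similar (Suc h) \<theta> T" "\<theta> ` T \<subseteq> Q"
        using Suc.prems(3)[of T] T P d_le full_tree_card[OF T(2)] by (metis order.trans)
      have "card (\<phi> ` I) = s" "card (\<psi> ` J) = s"
        using card_image[OF strict_mono_on_imp_inj_on[OF similar_strict_mono_on[OF \<phi>(1)]]] I(2)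
          card_image[OF strict_mono_on_imp_inj_on[OF similar_strict_mono_on[OF \<psi>(1)]]] J(2)
        by simp_all
      moreover have "2 ^ d + card (\<phi> ` I) + card (\<psi> ` J) \<le> card Q + 2 * d + 4"
        using full_tree_with_combs_bound[OF Suc.prems(1) \<phi>(2) _ \<psi>(2) _ \<theta>(2)]
          similar_Suc_comb(1)[OF \<phi>(1) comb_subset(1)[OF I0(2) I(1)]]
          similar_Suc_comb(2)[OF \<psi>(1) comb_subset(2)[OF J0(2) J(1)]]
          similar_Suc_full_tree[OF \<theta>(1) T(2)] by blast
      ultimately show False
        using Suc.prems(4) by linarith
    qed
  qed
  then show ?case
    by (simp add: u_def mult_2)
qed

section \<open>Colouring finite sets by similarity type\<close>

lemma ex_strict_mono_on_image:
  fixes e f :: "nat set"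
  assumes "finite e" "finite f" "card e = card f"
  obtains \<phi> where "strict_mono_on e \<phi>" "\<phi> ` e = f"
proof -
  obtain g where g: "bij_betw g {..<card e} e" "strict_mono_on {..<card e} g"
    using ex_bij_betw_strict_mono_card[OF assms(1)] .
  obtain g' where g': "bij_betw g' {..<card e} f" "strict_mono_on {..<card e} g'"
    using ex_bij_betw_strict_mono_card[OF assms(2)] assms(3) by metis
  define r where "r = inv_into {..<card e} g"
  have r: "r x \<in> {..<card e}" "g (r x) = x" if "x \<in> e" for x
    using that bij_betw_imp_surj_on[OF g(1)] unfolding r_def
    by (metis inv_into_into, metis f_inv_into_f)
  have "strict_mono_on e (g' \<circ> r)"
  proof (rule strict_mono_onI)
    fix x y assume xy: "x \<in> e" "y \<in> e" "x < y"
    have "r x < r y"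
    proof (rule ccontr)
      assume "\<not> r x < r y"
      then have "g (r y) \<le> g (r x)"
        using strict_mono_onD[OF g(2), of "r y" "r x"] r xy by (cases "r x = r y") auto
      then show False using r xy by simp
    qed
    then show "(g' \<circ> r) x < (g' \<circ> r) y"
      using strict_mono_onD[OF g'(2)] r xy by simp
  qed
  moreover have "r ` e = {..<card e}"
    unfolding r_def using bij_betw_inv_into[OF g(1)] by (simp add: bij_betw_def)
  then have "(g' \<circ> r) ` e = f"
    using g'(1) unfolding bij_betw_def image_comp[symmetric] by simp
  ultimately show thesis using that by blast
qed

definition rank :: "nat set \<Rightarrow> nat \<Rightarrow> nat" where
  "rank A x = card {y \<in> A. y < x}"

lemma rank_strict_mono_on:
  assumes "finite A"
  shows "strict_mono_on A (rank A)"
proof (rule strict_mono_onI)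
  fix x y assume "x \<in> A" "y \<in> A" "x < y"
  then show "rank A x < rank A y"
    unfolding rank_def using assms by (intro psubset_card_mono) auto
qed

lemma rank_less: "finite A \<Longrightarrow> x \<in> A \<Longrightarrow> rank A x < card A"
  unfolding rank_def by (rule psubset_card_mono) auto

lemma rank_image:
  assumes "strict_mono_on A \<phi>" "x \<in> A"
  shows "rank (\<phi> ` A) (\<phi> x) = rank A x"
proof -
  have "\<phi> y < \<phi> x \<longleftrightarrow> y < x" if "y \<in> A" for y
    using strict_mono_on_less[OF assms(1) that assms(2)] .
  then have "{y \<in> \<phi> ` A. y < \<phi> x} = \<phi> ` {y \<in> A. y < x}"
    by auto
  moreover have "inj_on \<phi> {y \<in> A. y < x}"
    using strict_mono_on_imp_inj_on[OF assms(1)] by (rule inj_on_subset) auto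
  ultimately show ?thesis
    by (simp add: rank_def card_image)
qed

text \<open>Ranks replace the numbers so that sets of bounded size have only finitely many patterns,
  whatever the ground set.\<close>

definition level_pattern :: "nat set \<Rightarrow> (nat \<times> nat \<times> nat) set" where
  "level_pattern A = {(rank A x, rank A y, rank (split_levels A) (split_level x y)) | x y.
     x \<in> A \<and> y \<in> A \<and> x < y}"

text \<open>The triple of \<open>x\<close> and \<open>y\<close> recurs in the pattern of
  \<open>f\<close>. Increasing maps preserve ranks and ranks determine elements, so it stems from
  \<open>\<phi> x\<close> and \<open>\<phi> y\<close>, and its last entry forces their level to be
  the \<open>\<psi>\<close>-image.\<close>

lemma similar_Suc_if_level_pattern_eq:
  assumes "finite e" "finite f" "strict_mono_on e \<phi>" "\<phi> ` e = f"
    and "similar h \<psi> (split_levels e)" "\<psi> ` split_levels e = split_levels f"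
    and "level_pattern e = level_pattern f"
  shows "similar (Suc h) \<phi> e"
proof -
  have "split_level (\<phi> x) (\<phi> y) = \<psi> (split_level x y)" if xy: "x \<in> e" "y \<in> e" "x < y" for x y
  proof -
    have l: "split_level x y \<in> split_levels e"
      using xy by (rule split_levelsI)
    have "(rank e x, rank e y, rank (split_levels e) (split_level x y)) \<in> level_pattern f"
      using xy assms(7) unfolding level_pattern_def by blast
    then obtain x' y' where xy': "x' \<in> f" "y' \<in> f" "x' < y'" "rank f x' = rank e x"
      "rank f y' = rank e y"
      "rank (split_levels f) (split_level x' y') = rank (split_levels e) (split_level x y)"
      unfolding level_pattern_def by auto
    have inj: "inj_on (rank f) f"
      using rank_strict_mono_on[OF assms(2)] by (rule strict_mono_on_imp_inj_on)
    have "rank f x' = rank f (\<phi> x)" "rank f y' = rank f (\<phi> y)"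
      using rank_image[OF assms(3)] xy xy' assms(4) by simp_all
    then have eq: "x' = \<phi> x" "y' = \<phi> y"
      using inj_onD[OF inj] xy xy' assms(4) by blast+
    have "finite (split_levels f)"
      using finite_card_split_levels[OF assms(2)] xy'(1) by blast
    then have "inj_on (rank (split_levels f)) (split_levels f)"
      using rank_strict_mono_on strict_mono_on_imp_inj_on by blast
    moreover have "rank (split_levels f) (\<psi> (split_level x y))
        = rank (split_levels f) (split_level x' y')"
      using rank_image[OF similar_strict_mono_on[OF assms(5)] l] xy' assms(6) by simp
    moreover have "\<psi> (split_level x y) \<in> split_levels f" "split_level x' y' \<in> split_levels f"
      using l assms(6) xy' by (auto intro: split_levelsI)
    ultimately show ?thesis
      using eq by (metis inj_onD)
  qed
  then show ?thesis
    using assms(3,5) by auto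
qed

text \<open>The colour for \<open>Suc h\<close> encodes the cardinality, the level pattern and the
  colour for \<open>h\<close> of the set of levels. Sets smaller than \<open>n\<close> are included
  because the set of levels may be smaller; \<open>q\<close> depends on \<open>n\<close> and
  \<open>h\<close> but on no ground set.\<close>

lemma ex_similarity_colouring:
  "\<exists>(col :: nat set \<Rightarrow> nat) q. (\<forall>e. finite e \<and> card e \<le> n \<longrightarrow> col e < q) \<and>
     (\<forall>e f. finite e \<and> finite f \<and> card e \<le> n \<and> card f \<le> n \<and> col e = col f \<longrightarrow>
        (\<exists>\<phi>. similar h \<phi> e \<and> \<phi> ` e = f))"
proof (induction h)
  case 0
  have "\<exists>\<phi>. strict_mono_on e \<phi> \<and> \<phi> ` e = f" if "finite e" "finite f" "card e = card f"
    for e f :: "nat set"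
    using ex_strict_mono_on_image[OF that] by blast
  then show ?case
    by (intro exI[of _ card] exI[of _ "Suc n"]) auto
next
  case (Suc h)
  then obtain col :: "nat set \<Rightarrow> nat" and q where
    col: "\<And>e. finite e \<Longrightarrow> card e \<le> n \<Longrightarrow> col e < q"
    "\<And>e f. finite e \<Longrightarrow> finite f \<Longrightarrow> card e \<le> n \<Longrightarrow> card f \<le> n \<Longrightarrow> col e = col f \<Longrightarrow>
        \<exists>\<phi>. similar h \<phi> e \<and> \<phi> ` e = f"
    by metis
  define R where "R = {..n} \<times> Pow ({..<n} \<times> {..<n} \<times> {..<n}) \<times> {..<q}"
  define type where "type = (\<lambda>e. (card e, level_pattern e, col (split_levels e)))"
  have levels: "finite (split_levels e) \<and> card (split_levels e) \<le> n" if "finite e" "card e \<le> n" for e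
    using finite_card_split_levels[of e] that by (cases "e = {}") (auto simp: split_levels_def)
  have type: "type e \<in> R" if "finite e" "card e \<le> n" for e
  proof -
    have "rank e x < n" if "x \<in> e" for x
      using rank_less[of e x] that \<open>finite e\<close> \<open>card e \<le> n\<close> by simp
    moreover have "rank (split_levels e) l < n" if "l \<in> split_levels e" for l
      using rank_less[of "split_levels e" l] levels[of e] that \<open>finite e\<close> \<open>card e \<le> n\<close> by simp
    ultimately have "level_pattern e \<subseteq> {..<n} \<times> {..<n} \<times> {..<n}"
      unfolding level_pattern_def by (auto intro: split_levelsI)
    then show ?thesis
      using that col(1) levels[OF that] by (simp add: R_def type_def)
  qed
  have "finite R"
    by (simp add: R_def)
  then obtain F and p :: nat where F: "F ` R = {i. i < p}" "inj_on F R"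
    using finite_imp_inj_to_nat_seg[of R] by auto
  have "\<exists>\<phi>. similar (Suc h) \<phi> e \<and> \<phi> ` e = f"
    if ef: "finite e" "finite f" "card e \<le> n" "card f \<le> n" "(F \<circ> type) e = (F \<circ> type) f" for e f
  proof -
    have "type e = type f"
      using inj_onD[OF F(2)] type ef by simp
    then have eq: "card e = card f" "level_pattern e = level_pattern f"
      "col (split_levels e) = col (split_levels f)"
      by (auto simp: type_def)
    obtain \<phi> where \<phi>: "strict_mono_on e \<phi>" "\<phi> ` e = f"
      using ex_strict_mono_on_image[OF ef(1,2) eq(1)] .
    obtain \<psi> where \<psi>: "similar h \<psi> (split_levels e)" "\<psi> ` split_levels e = split_levels f"
      using col(2)[OF _ _ _ _ eq(3)] levels ef by blast
    show ?thesis
      using similar_Suc_if_level_pattern_eq[OF ef(1,2) \<phi> \<psi> eq(2)] \<phi>(2) by blast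
  qed
  moreover have "(F \<circ> type) e < p" if "finite e" "card e \<le> n" for e
    using F(1) type[OF that] by auto
  ultimately show ?case
    by (intro exI[of _ "F \<circ> type"] exI[of _ p]) blast
qed

section \<open>The lower bound\<close>

text \<open>Each step is a fixed power of a linear expression. Using \<open>Suc N >= 1\<close> as
  base lets powers of it absorb the additive constants.\<close>

lemma similar_bound_le_poly: "\<exists>C e. \<forall>N. similar_bound K h N \<le> C * Suc N ^ e"
proof (induction h)
  case 0
  show ?case
    by (intro exI[of _ 1]) simp
next
  case (Suc h)
  then obtain C e where C: "\<And>N. similar_bound K h N \<le> C * Suc N ^ e" by blast
  have "similar_bound K (Suc h) N \<le> (2 * C + 4) ^ K * Suc N ^ (e * K)" for N
  proof -
    have "2 * (similar_bound K h N + 2) \<le> 2 * (C * Suc N ^ e + 2 * Suc N ^ e)"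
      using C[of N] one_le_power[of "Suc N" e] by (intro mult_left_mono add_mono) simp_all
    also have "\<dots> = (2 * C + 4) * Suc N ^ e"
      by (simp add: algebra_simps)
    finally show ?thesis
      using power_mono by (fastforce simp: power_mult_distrib power_mult)
  qed
  then show ?case by blast
qed

text \<open>The shift anticipates \<open>2 ^ N <= t < 2 ^ Suc N\<close>: the body has at least
  \<open>2 ^ N\<close> vertices, while the ground set is measured by \<open>Suc N\<close>.\<close>

lemma similar_bound_less_power: "\<forall>\<^sub>F N in sequentially. similar_bound K h (Suc N) < 2 ^ N"
proof -
  obtain C e where C: "\<And>N. similar_bound K h N \<le> C * Suc N ^ e"
    using similar_bound_le_poly by blast
  have "\<forall>\<^sub>F N in sequentially. real C * (real N + 2) ^ e < 2 ^ N"
    by real_asymp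
  then show ?thesis
  proof eventually_elim
    case (elim N)
    have "real (C * Suc (Suc N) ^ e) < real (2 ^ N)"
      using elim by (simp add: add.commute)
    then show ?case
      using C[of "Suc N"] by linarith
  qed
qed

lemma tower_le_tower_Suc:
  assumes "t \<le> 2 ^ N"
  shows "tower (Suc h) t \<le> tower (Suc (Suc h)) N"
  using assms by (induction h) simp_all

lemma le_ramsey_numberI:
  assumes "uniform_hypergraph k G" "\<And>n. n < m \<Longrightarrow> \<not> ramsey_arrows k G q n"
  shows "m \<le> ramsey_number k G q"
  unfolding ramsey_number_def using LeastI_ex[OF ramsey_arrows_ex[OF assms(1)]] assms(2)
  by (meson not_le_imp_less)

text \<open>At most \<open>k + 1\<close> body vertices always lie in one edge, which has the colour
  of \<open>Q\<close>, so they are similar to a subset of \<open>Q\<close>. As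
  \<open>card Q = 2 * k + 1\<close> is just below \<open>2 * (k + 1)\<close>, two combs of size
  \<open>s = Suc k\<close> nearly exhaust it and \<open>card_le_similar_bound\<close>
  applies.\<close>

lemma not_ramsey_arrows_hedgehog:
  fixes col :: "nat set \<Rightarrow> nat"
  assumes "\<And>e. finite e \<Longrightarrow> card e \<le> 2 * k + 1 \<Longrightarrow> col e < q"
    and "\<And>e f. finite e \<Longrightarrow> finite f \<Longrightarrow> card e \<le> 2 * k + 1 \<Longrightarrow> card f \<le> 2 * k + 1 \<Longrightarrow>
      col e = col f \<Longrightarrow> \<exists>\<phi>. similar h \<phi> e \<and> \<phi> ` e = f"
    and "n \<le> tower (Suc h) N" "similar_bound (Suc k) h N < t" "Suc k \<le> t"
    and "2 ^ d + h \<le> k + 2" "h + 2 * d + 3 \<le> 2 ^ d"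
  shows "\<not> ramsey_arrows (2 * k + 1) (balanced_hedgehog (2 * k + 1) t) q n"
proof
  let ?G = "balanced_hedgehog (2 * k + 1) t" and ?H = "complete_hypergraph (2 * k + 1) n"
  assume "ramsey_arrows (2 * k + 1) ?G q n"
  moreover have "col \<in> edges ?H \<rightarrow> {..<q}"
    using assms(1) by (auto simp: complete_hypergraph_def nsets_def)
  ultimately obtain f i where f: "embedding f ?G ?H" and mono: "\<And>e. e \<in> edges ?G \<Longrightarrow> col (f ` e) = i"
    unfolding ramsey_arrows_def by blast
  define S where "S = (\<lambda>x. f (Inl x)) ` {..<t}"
  have edge: "f ` e \<in> edges ?H" if "e \<in> edges ?G" for e
    using f that by (simp add: embedding_def)
  have body: "hedgehog_body t \<subseteq> verts ?G"
    by (simp add: balanced_hedgehog_def Let_def)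
  have inj: "inj_on (\<lambda>x. f (Inl x)) {..<t}"
  proof -
    have "inj_on f (Inl ` {..<t})"
      using f body inj_on_subset unfolding embedding_def hedgehog_body_def by blast
    then show ?thesis
      using comp_inj_on[of Inl "{..<t}" f] by (simp add: comp_def)
  qed
  have "S = f ` hedgehog_body t"
    by (auto simp: S_def hedgehog_body_def)
  then have "S \<subseteq> {..<n}"
    using f body unfolding embedding_def complete_hypergraph_def by auto
  have cardS: "card S = t"
    unfolding S_def using inj by (simp add: card_image)
  have hedge: "hedgehog_edge (2 * k + 1) Y \<in> edges ?G" if "Y \<subseteq> {..<t}" "card Y = Suc k" for Y
    using that finite_subset[OF that(1)] by (auto simp: balanced_hedgehog_def Let_def nsets_def)
  have fin: "finite (f ` e) \<and> card (f ` e) = 2 * k + 1" if "e \<in> edges ?G" for e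
    using edge[OF that] by (auto simp: complete_hypergraph_def nsets_def)
  \<comment> \<open>Any edge can serve as reference; this one exists because
    \<open>Suc k <= t\<close>.\<close>
  define Q where "Q = f ` hedgehog_edge (2 * k + 1) {..<Suc k}"
  have G0: "hedgehog_edge (2 * k + 1) {..<Suc k} \<in> edges ?G"
    using assms(5) by (intro hedge) auto
  have Q: "finite Q" "card Q = 2 * k + 1" "col Q = i"
    using fin[OF G0] mono[OF G0] by (simp_all add: Q_def)
  have "card S \<le> similar_bound (Suc k) h N"
  proof (rule card_le_similar_bound[OF Q(1), where d = d])
    show "S \<subseteq> {..<tower (Suc h) N}"
      using \<open>S \<subseteq> {..<n}\<close> assms(3) by auto
    show "\<exists>\<phi>. similar h \<phi> X \<and> \<phi> ` X \<subseteq> Q" if X: "X \<subseteq> S" "card X \<le> Suc k" for X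
    proof -
      have "finite S" by (simp add: S_def)
      then obtain X' where X': "X \<subseteq> X'" "X' \<subseteq> S" "card X' = Suc k"
        using exists_subset_between[of X "Suc k" S] X cardS assms(5) by auto
      then obtain Y where Y: "Y \<subseteq> {..<t}" "X' = (\<lambda>x. f (Inl x)) ` Y"
        unfolding S_def by (meson subset_imageE)
      then have "card Y = Suc k"
        using X'(3) inj by (metis card_image inj_on_subset)
      note Y_edge = hedge[OF Y(1) this]
      obtain \<phi> where \<phi>: "similar h \<phi> (f ` hedgehog_edge (2 * k + 1) Y)"
        "\<phi> ` f ` hedgehog_edge (2 * k + 1) Y = Q"
        using assms(2)[of "f ` hedgehog_edge (2 * k + 1) Y" Q] fin[OF Y_edge] mono[OF Y_edge] Q
        by auto
      have "X \<subseteq> f ` hedgehog_edge (2 * k + 1) Y"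
        using X'(1) Y(2) by (auto simp: hedgehog_edge_def)
      then show ?thesis
        using similar_subset[OF \<phi>(1)] \<phi>(2) by blast
    qed
  qed (use Q(2) assms(6,7) in simp_all)
  then show False
    using cardS assms(4) by simp
qed

lemma hedgehog_ramsey_lower_bound:
  assumes "1 \<le> h" "2 ^ (h + 4) + h \<le> k + 2"
  shows "\<exists>q. \<forall>\<^sub>F t in sequentially.
    tower h t \<le> ramsey_number (2 * k + 1) (balanced_hedgehog (2 * k + 1) t) q"
proof -
  obtain col :: "nat set \<Rightarrow> nat" and q where
    col: "\<And>e. finite e \<Longrightarrow> card e \<le> 2 * k + 1 \<Longrightarrow> col e < q"
    "\<And>e f. finite e \<Longrightarrow> finite f \<Longrightarrow> card e \<le> 2 * k + 1 \<Longrightarrow> card f \<le> 2 * k + 1 \<Longrightarrow>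
      col e = col f \<Longrightarrow> \<exists>\<phi>. similar h \<phi> e \<and> \<phi> ` e = f"
    using ex_similarity_colouring[of "2 * k + 1" h] by metis
  obtain h' where h': "h = Suc h'"
    using assms(1) by (cases h) auto
  \<comment> \<open>The tree depth is chosen as \<open>d = h + 4\<close>, large enough for
    \<open>2 ^ d\<close> to beat the linear terms.\<close>
  have "3 * h + 11 \<le> 16 * 2 ^ h"
    using less_exp[of h] by linarith
  then have d: "h + 2 * (h + 4) + 3 \<le> 2 ^ (h + 4)"
    by (simp add: power_add)
  obtain N0 where N0: "\<And>N. N0 \<le> N \<Longrightarrow> similar_bound (Suc k) h (Suc N) < 2 ^ N"
    using similar_bound_less_power unfolding eventually_sequentially by blast
  have "tower h t \<le> ramsey_number (2 * k + 1) (balanced_hedgehog (2 * k + 1) t) q"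
    if t: "2 ^ N0 + Suc k \<le> t" for t
  proof (rule le_ramsey_numberI[OF uniform_balanced_hedgehog])
    fix n assume n: "n < tower h t"
    \<comment> \<open>Measuring \<open>t\<close> by its binary length gains one exponential,
      \<open>tower h t <= tower (Suc h) (Suc N)\<close>, while the similarity bound is still below
      \<open>2 ^ N <= t\<close>.\<close>
    obtain N where N: "2 ^ N \<le> t" "t < 2 ^ Suc N"
      using ex_power_ivl1[of 2 t] t by auto
    have "(2::nat) ^ N0 < 2 ^ Suc N"
      using t N by linarith
    then have "N0 < Suc N"
      by (rule power_less_imp_less_exp[rotated]) simp
    then have "similar_bound (Suc k) h (Suc N) < t"
      using N0[of N] N(1) by linarith
    moreover have "n \<le> tower (Suc h) (Suc N)"
      using tower_le_tower_Suc[of t "Suc N" h'] N(2) n unfolding h' by linarith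
    moreover have "Suc k \<le> t"
      using t by linarith
    ultimately show "\<not> ramsey_arrows (2 * k + 1) (balanced_hedgehog (2 * k + 1) t) q n"
      by (intro not_ramsey_arrows_hedgehog[OF col _ _ _ assms(2) d])
  qed
  then show ?thesis
    unfolding eventually_sequentially by blast
qed

section \<open>The upper bound\<close>

text \<open>Extend a disjoint family greedily. If this gets stuck before \<open>M\<close> members,
  their union meets every set in \<open>F\<close> and is small.\<close>

lemma small_cover_or_disjoint_family:
  assumes "\<And>A. A \<in> F \<Longrightarrow> finite A \<and> card A \<le> k"
  shows "(\<exists>C. finite C \<and> card C \<le> k * M \<and> (\<forall>A\<in>F. A \<inter> C \<noteq> {})) \<or>
    (\<exists>A::nat \<Rightarrow> 'a set. (\<forall>i<M. A i \<in> F) \<and> disjoint_family_on A {..<M})"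
proof (induction M)
  case 0
  then show ?case by (simp add: disjoint_family_on_def)
next
  case (Suc M)
  then consider C where "finite C" "card C \<le> k * M" "\<forall>A\<in>F. A \<inter> C \<noteq> {}"
    | A :: "nat \<Rightarrow> 'a set" where "\<forall>i<M. A i \<in> F" "disjoint_family_on A {..<M}"
    by blast
  then show ?case
  proof cases
    case 1
    then show ?thesis by (intro disjI1 exI[of _ C]) auto
  next
    case 2
    define U where "U = (\<Union>i<M. A i)"
    have "finite U"
      using 2(1) assms by (auto simp: U_def)
    have "card U \<le> (\<Sum>i<M. card (A i))"
      unfolding U_def by (rule card_UN_le) simp
    also have "\<dots> \<le> (\<Sum>i<M. k)"
      using 2(1) assms by (intro sum_mono) auto
    finally have "card U \<le> k * Suc M" by (simp add: mult.commute)
    show ?thesis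
    proof (cases "\<forall>B\<in>F. B \<inter> U \<noteq> {}")
      case True
      then show ?thesis using \<open>finite U\<close> \<open>card U \<le> k * Suc M\<close> by blast
    next
      case False
      then obtain B where B: "B \<in> F" "B \<inter> U = {}" by blast
      have "disjoint_family_on (A(M := B)) {..<Suc M}"
        unfolding disjoint_family_on_def
      proof (intro ballI impI)
        fix i j assume ij: "i \<in> {..<Suc M}" "j \<in> {..<Suc M}" "i \<noteq> j"
        have AB: "A l \<inter> B = {}" "B \<inter> A l = {}" if "l < M" for l
          using B(2) that by (auto simp: U_def)
        consider "i = M" "j < M" | "i < M" "j = M" | "i < M" "j < M"
          using ij by fastforce
        then show "(A(M := B)) i \<inter> (A(M := B)) j = {}"
          by cases (use AB ij(3) disjoint_family_onD[OF 2(2), of i j] in simp_all)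
      qed
      moreover have "\<forall>i<Suc M. (A(M := B)) i \<in> F"
        using 2(1) B(1) by (simp add: less_Suc_eq)
      ultimately show ?thesis by blast
    qed
  qed
qed

text \<open>Picking a point of \<open>W\<close> in each member that is hit is injective by
  disjointness.\<close>

lemma card_hit_disjoint_family:
  assumes "disjoint_family_on A I" "finite W"
  shows "card {i \<in> I. A i \<inter> W \<noteq> {}} \<le> card W"
proof -
  define g where "g i = (SOME x. x \<in> A i \<inter> W)" for i
  have g: "g i \<in> A i \<inter> W" if "A i \<inter> W \<noteq> {}" for i
    unfolding g_def using that by (rule some_in_eq[THEN iffD2])
  have "inj_on g {i \<in> I. A i \<inter> W \<noteq> {}}"
  proof (rule inj_onI)
    fix i j assume ij: "i \<in> {i \<in> I. A i \<inter> W \<noteq> {}}" "j \<in> {i \<in> I. A i \<inter> W \<noteq> {}}" "g i = g j"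
    then have "g i \<in> A i" "g i \<in> A j"
      using g[of i] g[of j] by auto
    then show "i = j"
      using assms(1) ij unfolding disjoint_family_on_def by blast
  qed
  then show ?thesis
    using g assms(2) by (intro card_inj_on_le[of g _ W]) auto
qed

text \<open>Each \<open>W i\<close> spoils at most \<open>w\<close> pairs and each
  \<open>W' j\<close> at most \<open>w'\<close>, hence at most \<open>M * (w + w') < M * M\<close>
  pairs are spoilt in all.\<close>

lemma ex_mutually_avoiding_pair:
  assumes "disjoint_family_on A {..<M}" "disjoint_family_on B {..<M}"
    and "\<And>i. i < M \<Longrightarrow> finite (W i) \<and> card (W i) \<le> w"
    and "\<And>j. j < M \<Longrightarrow> finite (W' j) \<and> card (W' j) \<le> w'"
    and "w + w' < M"
  obtains i j where "i < M" "j < M" "B j \<inter> W i = {}" "A i \<inter> W' j = {}"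
proof -
  define P where "P = (SIGMA i:{..<M}. {j \<in> {..<M}. B j \<inter> W i \<noteq> {}})"
  define P' where "P' = (SIGMA j:{..<M}. {i \<in> {..<M}. A i \<inter> W' j \<noteq> {}})"
  have "card P = (\<Sum>i<M. card {j \<in> {..<M}. B j \<inter> W i \<noteq> {}})"
    unfolding P_def by simp
  also have "\<dots> \<le> (\<Sum>i<M. w)"
    using card_hit_disjoint_family[OF assms(2)] assms(3) by (intro sum_mono) (meson lessThan_iff order.trans)
  finally have P: "card P \<le> M * w" by simp
  have "card P' = (\<Sum>j<M. card {i \<in> {..<M}. A i \<inter> W' j \<noteq> {}})"
    unfolding P'_def by simp
  also have "\<dots> \<le> (\<Sum>j<M. w')"
    using card_hit_disjoint_family[OF assms(1)] assms(4) by (intro sum_mono) (meson lessThan_iff order.trans)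
  finally have P': "card P' \<le> M * w'" by simp
  have fin: "finite P" "finite P'"
    by (simp_all add: P_def P'_def)
  have "card (P \<union> prod.swap ` P') \<le> card P + card P'"
    using card_Un_le card_image_le[OF fin(2)] by (meson add_left_mono order.trans)
  also have "\<dots> \<le> M * (w + w')"
    using P P' by (simp add: distrib_left)
  also have "\<dots> < M * M"
    using assms(5) by simp
  also have "\<dots> = card ({..<M} \<times> {..<M})"
    by simp
  finally have "\<not> {..<M} \<times> {..<M} \<subseteq> P \<union> prod.swap ` P'"
    using card_mono[of "P \<union> prod.swap ` P'" "{..<M} \<times> {..<M}"] fin by auto
  then obtain i j where "i < M" "j < M" "(i, j) \<notin> P" "(j, i) \<notin> P'"
    by force
  then show thesis
    using that by (auto simp: P_def P'_def)
qed

section \<open>Sets that are bad for a colour, and their covers\<close>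

text \<open>The negation is badness for colour \<open>c\<close>. Robustness against \<open>D\<close>
  forbidden vertices later allows petals to be chosen disjointly one after another.\<close>

definition extendable :: "nat \<Rightarrow> nat \<Rightarrow> nat \<Rightarrow> (nat set \<Rightarrow> nat) \<Rightarrow> nat \<Rightarrow> nat set \<Rightarrow> bool" where
  "extendable n k D \<chi> c X \<longleftrightarrow> (\<forall>W. finite W \<and> card W \<le> D \<longrightarrow>
     (\<exists>Z. Z \<subseteq> {..<n} \<and> card Z = k \<and> Z \<inter> (W \<union> X) = {} \<and> \<chi> (X \<union> Z) = c))"

lemma nonextendable_cover:
  assumes "\<chi> \<in> [{..<n}]\<^bsup>(2 * k + 1)\<^esup> \<rightarrow> {..<2}" "v < n"
  obtains c C where "c < 2" "finite C" "card C \<le> k * (2 * D + k + 1)"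
    "\<And>X. X \<in> [{..<n}]\<^bsup>(k + 1)\<^esup> \<Longrightarrow> v \<in> X \<Longrightarrow> \<not> extendable n k D \<chi> c X \<Longrightarrow> (X - {v}) \<inter> C \<noteq> {}"
proof (rule ccontr)
  note found = that
  assume "\<not> thesis"
  \<comment> \<open>Bad sets through \<open>v\<close> always intersect; only after removing
    \<open>v\<close> can they form disjoint families.\<close>
  define F where "F c = {X - {v} | X. X \<in> [{..<n}]\<^bsup>(k + 1)\<^esup> \<and> v \<in> X \<and> \<not> extendable n k D \<chi> c X}" for c
  have F: "A \<subseteq> {..<n} \<and> v \<notin> A \<and> finite A \<and> card A = k \<and> \<not> extendable n k D \<chi> c (insert v A)"
    if A: "A \<in> F c" for A c
  proof -
    obtain X where X: "A = X - {v}" "X \<in> [{..<n}]\<^bsup>(k + 1)\<^esup>" "v \<in> X" "\<not> extendable n k D \<chi> c X"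
      using A by (auto simp: F_def)
    then have "insert v A = X" by blast
    then show ?thesis
      using X by (auto simp: nsets_def)
  qed
  define M where "M = 2 * D + k + 1"
  have "\<exists>A::nat \<Rightarrow> nat set. (\<forall>i<M. A i \<in> F c) \<and> disjoint_family_on A {..<M}" if "c < 2" for c
  proof (rule ccontr)
    assume "\<not> ?thesis"
    then obtain C where C: "finite C" "card C \<le> k * M" "\<forall>A\<in>F c. A \<inter> C \<noteq> {}"
      using small_cover_or_disjoint_family[of "F c" k M] F by blast
    have "(X - {v}) \<inter> C \<noteq> {}"
      if "X \<in> [{..<n}]\<^bsup>(k + 1)\<^esup>" "v \<in> X" "\<not> extendable n k D \<chi> c X" for X
      using C(3) that unfolding F_def by blast
    then show False
      using \<open>\<not> thesis\<close> found[OF \<open>c < 2\<close> C(1,2)[unfolded M_def]] by blast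
  qed
  from this[of 0] this[of 1] obtain A B :: "nat \<Rightarrow> nat set" where
    A: "\<And>i. i < M \<Longrightarrow> A i \<in> F 0" "disjoint_family_on A {..<M}" and
    B: "\<And>i. i < M \<Longrightarrow> B i \<in> F 1" "disjoint_family_on B {..<M}"
    by auto
  define blocks where "blocks c Y W \<longleftrightarrow> finite W \<and> card W \<le> D \<and>
    (\<forall>Z. Z \<subseteq> {..<n} \<and> card Z = k \<and> Z \<inter> (W \<union> insert v Y) = {} \<longrightarrow> \<chi> (insert v Y \<union> Z) \<noteq> c)" for c Y W
  define W where "W c Y = (SOME W. blocks c Y W)" for c Y
  have "blocks c Y (W c Y)" if "Y \<in> F c" for Y c
    unfolding W_def
  proof (rule someI_ex)
    show "\<exists>W. blocks c Y W"
      using F[OF that] unfolding extendable_def blocks_def by blast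
  qed
  then have W: "\<And>Y c. Y \<in> F c \<Longrightarrow> finite (W c Y) \<and> card (W c Y) \<le> D"
    "\<And>Y c Z. Y \<in> F c \<Longrightarrow> Z \<subseteq> {..<n} \<Longrightarrow> card Z = k \<Longrightarrow> Z \<inter> (W c Y \<union> insert v Y) = {} \<Longrightarrow>
      \<chi> (insert v Y \<union> Z) \<noteq> c"
    unfolding blocks_def by blast+
  \<comment> \<open>Adding \<open>A i\<close> to its blocker makes the chosen \<open>A i\<close> and
    \<open>B j\<close> disjoint, so that \<open>e\<close> has \<open>2 * k + 1\<close> vertices.
    This accounts for the \<open>k\<close> in \<open>M = (D + k) + D + 1\<close>.\<close>
  have WA: "finite (W 0 (A i) \<union> A i) \<and> card (W 0 (A i) \<union> A i) \<le> D + k" if "i < M" for i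
    using W(1)[OF A(1)[OF that]] F[OF A(1)[OF that]] card_Un_le[of "W 0 (A i)" "A i"] by simp
  have WB: "finite (W 1 (B j)) \<and> card (W 1 (B j)) \<le> D" if "j < M" for j
    using W(1)[OF B(1)[OF that]] .
  have "D + k + D < M"
    by (simp add: M_def)
  obtain i j where ij: "i < M" "j < M" "B j \<inter> (W 0 (A i) \<union> A i) = {}" "A i \<inter> W 1 (B j) = {}"
    by (rule ex_mutually_avoiding_pair[OF A(2) B(2) WA WB \<open>D + k + D < M\<close>])
  have Fi: "A i \<subseteq> {..<n}" "v \<notin> A i" "finite (A i)" "card (A i) = k"
    and Fj: "B j \<subseteq> {..<n}" "v \<notin> B j" "finite (B j)" "card (B j) = k"
    using F[OF A(1)[OF ij(1)]] F[OF B(1)[OF ij(2)]] by auto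
  define e where "e = insert v (A i \<union> B j)"
  have "card (A i \<union> B j) = k + k"
    using Fi Fj ij(3) by (subst card_Un_disjoint) auto
  then have "e \<in> [{..<n}]\<^bsup>(2 * k + 1)\<^esup>"
    using Fi Fj assms(2) by (auto simp: e_def nsets_def)
  then have "\<chi> e < 2"
    using assms(1) by auto
  \<comment> \<open>\<open>B j\<close> is a petal at \<open>insert v (A i)\<close> outside the
    blocker for colour 0, and \<open>A i\<close> is one at \<open>insert v (B j)\<close> outside the
    blocker for colour 1.\<close>
  moreover have "\<chi> e \<noteq> 0"
    using W(2)[OF A(1)[OF ij(1)] Fj(1,4)] ij(3) Fj(2) by (auto simp: e_def)
  moreover have "\<chi> e \<noteq> 1"
    using W(2)[OF B(1)[OF ij(2)] Fi(1,4)] ij(3,4) Fi(2) by (auto simp: e_def Un_commute)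
  ultimately show False by simp
qed

section \<open>Finding the body and choosing the petals\<close>

text \<open>Read \<open>w \<in> C v\<close> as an arc from \<open>v\<close> to \<open>w\<close>.
  Out-degrees are at most \<open>L\<close>, so by averaging some \<open>v\<close> has in-degree at
  most \<open>L\<close>; taking it and deleting it with all its neighbours costs at most
  \<open>2 * L + 1\<close> vertices.\<close>

lemma ex_independent_subset:
  assumes "finite V" "\<And>v. v \<in> V \<Longrightarrow> finite (C v) \<and> card (C v) \<le> L" "(2 * L + 1) * t \<le> card V"
  shows "\<exists>S\<subseteq>V. card S = t \<and> (\<forall>v\<in>S. \<forall>w\<in>S. v \<noteq> w \<longrightarrow> w \<notin> C v)"
  using assms
proof (induction t arbitrary: V)
  case 0
  show ?case by (intro exI[of _ "{}"]) simp
next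
  case (Suc t)
  have "\<exists>v\<in>V. card {u \<in> V. v \<in> C u} \<le> L"
  proof (rule ccontr)
    assume "\<not> ?thesis"
    then have "(\<Sum>v\<in>V. Suc L) \<le> (\<Sum>v\<in>V. card {u \<in> V. v \<in> C u})"
      by (intro sum_mono) (auto simp: not_le Suc_le_eq)
    also have "\<dots> = (\<Sum>u\<in>V. card {v \<in> V. v \<in> C u})"
      using Suc.prems(1) by (intro sum_multicount_gen) auto
    also have "\<dots> \<le> (\<Sum>u\<in>V. L)"
    proof (rule sum_mono)
      fix u assume "u \<in> V"
      then have "card {v \<in> V. v \<in> C u} \<le> card (C u)"
        using Suc.prems(2) by (intro card_mono) auto
      then show "card {v \<in> V. v \<in> C u} \<le> L"
        using Suc.prems(2)[OF \<open>u \<in> V\<close>] by simp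
    qed
    finally have "card V = 0" by simp
    then show False using Suc.prems(3) by simp
  qed
  then obtain v where v: "v \<in> V" "card {u \<in> V. v \<in> C u} \<le> L" by blast
  define U where "U = insert v (C v \<union> {u \<in> V. v \<in> C u})"
  have "finite U"
    using Suc.prems v by (simp add: U_def)
  have "card U \<le> Suc (card (C v \<union> {u \<in> V. v \<in> C u}))"
    unfolding U_def by (rule card_insert_le_m1) simp_all
  also have "\<dots> \<le> Suc (L + L)"
    using card_Un_le[of "C v" "{u \<in> V. v \<in> C u}"] v Suc.prems(2)[OF v(1)] by simp
  finally have "card U \<le> 2 * L + 1" by simp
  then have "(2 * L + 1) * t \<le> card (V - U)"
    using Suc.prems(3) diff_card_le_card_Diff[OF \<open>finite U\<close>, of V] by simp
  then obtain S where S: "S \<subseteq> V - U" "card S = t" "\<forall>v\<in>S. \<forall>w\<in>S. v \<noteq> w \<longrightarrow> w \<notin> C v"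
    using Suc.IH[of "V - U"] Suc.prems(1,2) by auto
  have "finite S" "v \<notin> S"
    using S(1) Suc.prems(1) finite_subset by (auto simp: U_def)
  then have "card (insert v S) = Suc t"
    using S(2) by simp
  moreover have "\<forall>x\<in>insert v S. \<forall>w\<in>insert v S. x \<noteq> w \<longrightarrow> w \<notin> C x"
    using S(1,3) by (auto simp: U_def)
  ultimately show ?case
    using S(1) v(1) by (intro exI[of _ "insert v S"]) auto
qed

text \<open>Greedy choice: \<open>S\<close> and the sets chosen before never exceed \<open>D\<close>
  elements together, so the next set can avoid them all.\<close>

lemma ex_disjoint_choice:
  assumes "finite F" "finite S" "card S + k * card F \<le> D"
    and "\<And>X W. X \<in> F \<Longrightarrow> finite W \<Longrightarrow> card W \<le> D \<Longrightarrow>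
      \<exists>Z. finite Z \<and> card Z = k \<and> Z \<inter> W = {} \<and> P X Z"
  shows "\<exists>Z. (\<forall>X\<in>F. finite (Z X) \<and> card (Z X) = k \<and> Z X \<inter> S = {} \<and> P X (Z X)) \<and>
    disjoint_family_on Z F"
  using assms
proof (induction F rule: finite_induct)
  case empty
  then show ?case by (simp add: disjoint_family_on_def)
next
  case (insert Y F)
  have "card S + k * card F \<le> D"
    using insert.prems(2) insert.hyps by simp
  then obtain Z where Z: "\<And>X. X \<in> F \<Longrightarrow> finite (Z X) \<and> card (Z X) = k \<and> Z X \<inter> S = {} \<and> P X (Z X)"
    "disjoint_family_on Z F"
    using insert.IH insert.prems by (metis insertCI)
  define W where "W = S \<union> (\<Union>X\<in>F. Z X)"
  have "finite W"
    using Z insert.hyps insert.prems(1) by (simp add: W_def)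
  have "card W \<le> card S + card (\<Union>X\<in>F. Z X)"
    unfolding W_def by (rule card_Un_le)
  also have "card (\<Union>X\<in>F. Z X) \<le> (\<Sum>X\<in>F. card (Z X))"
    using insert.hyps(1) by (rule card_UN_le)
  also have "(\<Sum>X\<in>F. card (Z X)) = k * card F"
    using Z(1) by simp
  finally have "card W \<le> D"
    using \<open>card S + k * card F \<le> D\<close> by linarith
  then obtain Z' where Z': "finite Z'" "card Z' = k" "Z' \<inter> W = {}" "P Y Z'"
    using insert.prems(3)[of Y W] \<open>finite W\<close> by blast
  have "Z' \<inter> S = {}" "\<And>X. X \<in> F \<Longrightarrow> Z' \<inter> Z X = {}"
    using Z'(3) by (auto simp: W_def)
  then show ?case
    using Z Z' insert.hyps(2)
    by (intro exI[of _ "Z(Y := Z')"]) (auto simp: disjoint_family_on_def)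
qed

text \<open>The bound on \<open>D\<close> counts the body and the petals of all its
  \<open>(k + 1)\<close>-subsets, so the greedy choice never runs out of room.\<close>

lemma hedgehog_embedding:
  assumes S: "S \<subseteq> {..<n}" "card S = t"
    and ext: "\<And>X. X \<in> [S]\<^bsup>(k + 1)\<^esup> \<Longrightarrow> extendable n k D \<chi> c X"
    and D: "t + k * (t choose (k + 1)) \<le> D"
  shows "\<exists>f. embedding f (balanced_hedgehog (2 * k + 1) t) (complete_hypergraph (2 * k + 1) n) \<and>
    (\<forall>e\<in>edges (balanced_hedgehog (2 * k + 1) t). \<chi> (f ` e) = c)"
proof -
  have "finite S"
    using S(1) finite_subset by blast
  have "\<exists>Z. finite Z \<and> card Z = k \<and> Z \<inter> W = {} \<and> (Z \<subseteq> {..<n} \<and> Z \<inter> X = {} \<and> \<chi> (X \<union> Z) = c)"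
    if X: "X \<in> [S]\<^bsup>(k + 1)\<^esup>" and W: "finite W" "card W \<le> D" for X W
  proof -
    obtain Z where "Z \<subseteq> {..<n}" "card Z = k" "Z \<inter> (W \<union> X) = {}" "\<chi> (X \<union> Z) = c"
      using ext[OF X] W unfolding extendable_def by blast
    moreover from this have "finite Z"
      using finite_subset by blast
    ultimately show ?thesis by blast
  qed
  moreover have "finite ([S]\<^bsup>(k + 1)\<^esup>)" "card ([S]\<^bsup>(k + 1)\<^esup>) = t choose (k + 1)"
    using \<open>finite S\<close> S(2) by (simp_all add: finite_imp_finite_nsets card_nsets)
  ultimately have ex: "\<exists>Z. (\<forall>X\<in>[S]\<^bsup>(k + 1)\<^esup>. finite (Z X) \<and> card (Z X) = k \<and> Z X \<inter> S = {} \<and>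
      (Z X \<subseteq> {..<n} \<and> Z X \<inter> X = {} \<and> \<chi> (X \<union> Z X) = c)) \<and> disjoint_family_on Z ([S]\<^bsup>(k + 1)\<^esup>)"
    using \<open>finite S\<close> S(2) D by (intro ex_disjoint_choice[where D = D]) simp_all
  obtain Z where Z0: "(\<forall>X\<in>[S]\<^bsup>(k + 1)\<^esup>. finite (Z X) \<and> card (Z X) = k \<and> Z X \<inter> S = {} \<and>
      (Z X \<subseteq> {..<n} \<and> Z X \<inter> X = {} \<and> \<chi> (X \<union> Z X) = c)) \<and> disjoint_family_on Z ([S]\<^bsup>(k + 1)\<^esup>)"
    using ex ..
  then have Z: "finite (Z X) \<and> card (Z X) = k \<and> Z X \<inter> S = {} \<and>
      Z X \<subseteq> {..<n} \<and> Z X \<inter> X = {} \<and> \<chi> (X \<union> Z X) = c" if "X \<in> [S]\<^bsup>(k + 1)\<^esup>" for X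
    using that by simp
  have disj: "disjoint_family_on Z ([S]\<^bsup>(k + 1)\<^esup>)"
    using Z0 by simp
  obtain \<sigma> where \<sigma>: "bij_betw \<sigma> {..<t} S"
    using ex_bij_betw_nat_finite[OF \<open>finite S\<close>] S(2) by (auto simp: atLeast0LessThan)
  have \<sigma>_inj: "inj_on \<sigma> {..<t}" and \<sigma>_im: "\<sigma> ` {..<t} = S"
    using \<sigma> by (auto simp: bij_betw_def)
  have "\<exists>g. bij_betw g {..<k} (Z X)" if "X \<in> [S]\<^bsup>(k + 1)\<^esup>" for X
    using ex_bij_betw_nat_finite[of "Z X"] Z[OF that] by (auto simp: atLeast0LessThan)
  then obtain g where g: "\<And>X. X \<in> [S]\<^bsup>(k + 1)\<^esup> \<Longrightarrow> bij_betw (g X) {..<k} (Z X)"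
    by metis
  define f where "f = case_sum \<sigma> (\<lambda>(Y, j). g (\<sigma> ` Y) j)"
  have f_simps: "f (Inl i) = \<sigma> i" "f (Inr (Y, j)) = g (\<sigma> ` Y) j" for i Y j
    by (simp_all add: f_def)
  have \<sigma>Y: "\<sigma> ` Y \<in> [S]\<^bsup>(k + 1)\<^esup>" if "Y \<in> [{..<t}]\<^bsup>(k + 1)\<^esup>" for Y
  proof -
    have "Y \<subseteq> {..<t}" "finite Y" "card Y = k + 1"
      using that by (auto simp: nsets_def)
    then show ?thesis
      using \<sigma>_im card_image[OF inj_on_subset[OF \<sigma>_inj]] by (auto simp: nsets_def)
  qed
  let ?G = "balanced_hedgehog (2 * k + 1) t" and ?H = "complete_hypergraph (2 * k + 1) n"
  have edges: "edges ?G = hedgehog_edge (2 * k + 1) ` ([{..<t}]\<^bsup>(k + 1)\<^esup>)"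
    by (simp add: balanced_hedgehog_def Let_def)
  have verts: "verts ?G = Inl ` {..<t} \<union> {Inr (Y, j) | Y j. Y \<in> [{..<t}]\<^bsup>(k + 1)\<^esup> \<and> j < k}"
    by (auto simp: balanced_hedgehog_def Let_def hedgehog_body_def hedgehog_edge_def nsets_def)
  have f_edge: "f ` hedgehog_edge (2 * k + 1) Y = \<sigma> ` Y \<union> Z (\<sigma> ` Y)"
    if "Y \<in> [{..<t}]\<^bsup>(k + 1)\<^esup>" for Y
    using bij_betw_imp_surj_on[OF g[OF \<sigma>Y[OF that]]]
    by (simp add: hedgehog_edge_def image_Un image_image f_simps)
  have g_in: "g (\<sigma> ` Y) j \<in> Z (\<sigma> ` Y)" if "Y \<in> [{..<t}]\<^bsup>(k + 1)\<^esup>" "j < k" for Y j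
    using bij_betwE[OF g[OF \<sigma>Y[OF that(1)]]] that(2) by auto
  have petals: "Y = Y' \<and> j = j'"
    if Y: "Y \<in> [{..<t}]\<^bsup>(k + 1)\<^esup>" "Y' \<in> [{..<t}]\<^bsup>(k + 1)\<^esup>" "j < k" "j' < k"
      and eq: "g (\<sigma> ` Y) j = g (\<sigma> ` Y') j'" for Y Y' j j'
  proof -
    have "\<sigma> ` Y = \<sigma> ` Y'"
      using disj \<sigma>Y[OF Y(1)] \<sigma>Y[OF Y(2)] g_in[OF Y(1,3)] g_in[OF Y(2,4)] eq
      unfolding disjoint_family_on_def by (metis disjoint_iff)
    moreover have "Y \<subseteq> {..<t}" "Y' \<subseteq> {..<t}"
      using Y by (auto simp: nsets_def)
    ultimately have "Y = Y'"
      using inj_on_image_eq_iff[OF \<sigma>_inj] by blast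
    moreover from this have "j = j'"
      using g[OF \<sigma>Y[OF Y(1)]] eq Y(3,4) by (auto simp: bij_betw_def inj_on_def)
    ultimately show ?thesis by blast
  qed
  have body_petal: "\<sigma> i \<noteq> g (\<sigma> ` Y) j" if "i < t" "Y \<in> [{..<t}]\<^bsup>(k + 1)\<^esup>" "j < k" for i Y j
  proof -
    have "\<sigma> i \<in> S"
      using \<sigma>_im that(1) by auto
    moreover have "g (\<sigma> ` Y) j \<notin> S"
      using g_in[OF that(2,3)] Z[OF \<sigma>Y[OF that(2)]] by auto
    ultimately show ?thesis by auto
  qed
  have "inj_on f (verts ?G)"
  proof (rule inj_onI)
    fix x y assume "x \<in> verts ?G" "y \<in> verts ?G" "f x = f y"
    then show "x = y"
      unfolding verts using petals body_petal inj_onD[OF \<sigma>_inj]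
      by (auto simp: f_simps) metis+
  qed
  moreover have "f ` verts ?G \<subseteq> verts ?H"
    using g_in Z \<sigma>Y \<sigma>_im S(1)
    unfolding verts by (fastforce simp: f_simps complete_hypergraph_def)
  moreover have "f ` e \<in> edges ?H \<and> \<chi> (f ` e) = c" if "e \<in> edges ?G" for e
  proof -
    obtain Y where Y: "Y \<in> [{..<t}]\<^bsup>(k + 1)\<^esup>" "f ` e = \<sigma> ` Y \<union> Z (\<sigma> ` Y)"
      using \<open>e \<in> edges ?G\<close> f_edge unfolding edges by blast
    have X: "\<sigma> ` Y \<subseteq> S" "finite (\<sigma> ` Y)" "card (\<sigma> ` Y) = k + 1"
      using \<sigma>Y[OF Y(1)] by (auto simp: nsets_def)
    have "card (f ` e) = (k + 1) + k"
      unfolding Y(2) using X Z[OF \<sigma>Y[OF Y(1)]] by (subst card_Un_disjoint) auto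
    then show ?thesis
      using X Z[OF \<sigma>Y[OF Y(1)]] S(1) unfolding complete_hypergraph_def nsets_def Y(2)
      by auto
  qed
  ultimately show ?thesis
    unfolding embedding_def by blast
qed

lemma hedgehog_ramsey_upper_bound:
  "\<forall>\<^sub>F t in sequentially.
    ramsey_number (2 * k + 1) (balanced_hedgehog (2 * k + 1) t) 2 \<le> t ^ (k + 3)"
proof -
  have "ramsey_number (2 * k + 1) (balanced_hedgehog (2 * k + 1) t) 2 \<le> t ^ (k + 3)"
    \<comment> \<open>With \<open>p = t ^ (k + 1)\<close> the threshold is the coefficient in
      \<open>2 * (2 * L + 1) <= (12 * k * k + 12 * k + 2) * p\<close>. One factor \<open>t\<close>
      of \<open>n\<close> absorbs it, and another pays for the \<open>t\<close> vertices of the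
      body.\<close>
    if t: "12 * k * k + 12 * k + 2 \<le> t" for t
  proof -
    define n where "n = t ^ (k + 3)"
    define D where "D = t + k * t ^ (k + 1)"
    define L where "L = k * (2 * D + k + 1)"
    have t1: "1 \<le> t" using t by linarith
    define p where "p = t ^ (k + 1)"
    have p: "t \<le> p" "1 \<le> p"
      unfolding p_def using t1 self_le_power[of t "k + 1"] one_le_power[of t "k + 1"] by simp_all
    define a where "a = k * p"
    have "k \<le> a"
      using p by (simp add: a_def)
    then have "2 * D + k + 1 \<le> 3 * a + 3 * p"
      using p unfolding D_def p_def[symmetric] a_def[symmetric] by simp
    then have "2 * D + k + 1 \<le> (3 * k + 3) * p"
      by (simp add: a_def algebra_simps)
    then have "L \<le> k * ((3 * k + 3) * p)"
      unfolding L_def by (rule mult_left_mono) simp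
    have "2 * (2 * L + 1) = 4 * L + 2" by simp
    also have "\<dots> \<le> 4 * (k * ((3 * k + 3) * p)) + 2 * p"
      using p \<open>L \<le> k * ((3 * k + 3) * p)\<close> by linarith
    also have "\<dots> = (12 * k * k + 12 * k + 2) * p"
      by (simp add: algebra_simps)
    also have "\<dots> \<le> t * p"
      using t by (rule mult_right_mono) simp
    finally have "2 * (2 * L + 1) * t \<le> t * p * t"
      by (rule mult_right_mono) simp
    also have "\<dots> = n"
      unfolding n_def p_def by (simp add: power_add eval_nat_numeral ac_simps)
    finally have n: "2 * ((2 * L + 1) * t) \<le> n" by (simp add: algebra_simps)
    have D: "t + k * (t choose (k + 1)) \<le> D"
      unfolding D_def using binomial_le_pow[of "k + 1" t] t
      by (cases "k + 1 \<le> t") (auto simp: binomial_eq_0)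
    have "ramsey_arrows (2 * k + 1) (balanced_hedgehog (2 * k + 1) t) 2 n"
      unfolding ramsey_arrows_def
    proof
      fix \<chi> :: "nat set \<Rightarrow> nat" assume "\<chi> \<in> edges (complete_hypergraph (2 * k + 1) n) \<rightarrow> {..<2}"
      then have \<chi>: "\<chi> \<in> [{..<n}]\<^bsup>(2 * k + 1)\<^esup> \<rightarrow> {..<2}"
        by (simp add: complete_hypergraph_def)
      define covers where "covers c v C \<longleftrightarrow> finite C \<and> card C \<le> L \<and>
        (\<forall>X. X \<in> [{..<n}]\<^bsup>(k + 1)\<^esup> \<longrightarrow> v \<in> X \<longrightarrow> \<not> extendable n k D \<chi> c X \<longrightarrow> (X - {v}) \<inter> C \<noteq> {})"
        for c v C
      define V where "V c = {v \<in> {..<n}. \<exists>C. covers c v C}" for c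
      have "{..<n} \<subseteq> V 0 \<union> V 1"
      proof
        fix v assume "v \<in> {..<n}"
        then obtain c C where "c < 2" "covers c v C"
          using nonextendable_cover[OF \<chi>, of v D] unfolding covers_def L_def by (metis lessThan_iff)
        then show "v \<in> V 0 \<union> V 1"
          using \<open>v \<in> {..<n}\<close> by (auto simp: V_def less_2_cases_iff)
      qed
      moreover have finV: "finite (V c)" for c
        by (simp add: V_def)
      ultimately have "n \<le> card (V 0 \<union> V 1)"
        using card_mono[of "V 0 \<union> V 1" "{..<n}"] by simp
      then have "n \<le> card (V 0) + card (V 1)"
        using card_Un_le order.trans by blast
      \<comment> \<open>Each vertex has a small cover for one of the two colours, so one colour
        serves at least \<open>n / 2\<close> vertices.\<close>
      then have "(2 * L + 1) * t \<le> card (V 0) \<or> (2 * L + 1) * t \<le> card (V 1)"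
        using n by linarith
      then obtain c where c: "(2 * L + 1) * t \<le> card (V c)"
        by blast
      define C where "C v = (SOME C. covers c v C)" for v
      have C: "covers c v (C v)" if "v \<in> V c" for v
        unfolding C_def by (rule someI_ex) (use that in \<open>simp add: V_def\<close>)
      have "finite (C v) \<and> card (C v) \<le> L" if "v \<in> V c" for v
        using C[OF that] by (simp add: covers_def)
      then obtain S where S: "S \<subseteq> V c" "card S = t" "\<forall>v\<in>S. \<forall>w\<in>S. v \<noteq> w \<longrightarrow> w \<notin> C v"
        using ex_independent_subset[OF finV _ c] by blast
      have "S \<subseteq> {..<n}"
        using S(1) by (auto simp: V_def)
      \<comment> \<open>The cover of \<open>v\<close> would have to contain another vertex of a bad
        \<open>X\<close>, hence of \<open>S\<close>, against independence.\<close>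
      have ext: "extendable n k D \<chi> c X" if X: "X \<in> [S]\<^bsup>(k + 1)\<^esup>" for X
      proof (rule ccontr)
        assume bad: "\<not> extendable n k D \<chi> c X"
        have "X \<subseteq> S" "X \<noteq> {}"
          using X by (auto simp: nsets_def)
        then obtain v where v: "v \<in> X" "v \<in> S" by blast
        have "X \<in> [{..<n}]\<^bsup>(k + 1)\<^esup>"
          using X \<open>S \<subseteq> {..<n}\<close> by (auto simp: nsets_def)
        moreover have "covers c v (C v)"
          using C v(2) S(1) by blast
        ultimately have "(X - {v}) \<inter> C v \<noteq> {}"
          unfolding covers_def using v(1) bad by blast
        then obtain w where "w \<in> S" "v \<noteq> w" "w \<in> C v"
          using \<open>X \<subseteq> S\<close> by auto
        then show False
          using S(3)[THEN bspec, OF v(2), THEN bspec] by simp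
      qed
      show "\<exists>f i. embedding f (balanced_hedgehog (2 * k + 1) t) (complete_hypergraph (2 * k + 1) n) \<and>
          (\<forall>e\<in>edges (balanced_hedgehog (2 * k + 1) t). \<chi> (f ` e) = i)"
        by (subst ex_comm, intro exI[of _ c], rule hedgehog_embedding[OF \<open>S \<subseteq> {..<n}\<close> S(2) ext D])
    qed
    then show ?thesis
      unfolding ramsey_number_def n_def by (rule Least_le)
  qed
  then show ?thesis
    unfolding eventually_sequentially by blast
qed

section \<open>The height of the tower in terms of \<open>k\<close>\<close>

text \<open>The requirement on \<open>k\<close> is only exponential in \<open>h\<close>, whereas the
  constant 1/4 yields \<open>2 ^ 2 ^ (4 * h) <= k\<close>, which leaves ample room.\<close>

lemma height_le_if_log_log:
  assumes "2 \<le> k" "\<lfloor>1 / 4 * log 2 (log 2 (real k))\<rfloor> \<ge> 1"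
    and h: "h = nat \<lfloor>1 / 4 * log 2 (log 2 (real k))\<rfloor>"
  shows "1 \<le> h \<and> 2 ^ (h + 4) + h \<le> k + 2"
proof -
  have "real h = real_of_int \<lfloor>1 / 4 * log 2 (log 2 (real k))\<rfloor>"
    using assms by simp
  also have "\<dots> \<le> 1 / 4 * log 2 (log 2 (real k))"
    by (rule of_int_floor_le)
  finally have "real (4 * h) \<le> log 2 (log 2 (real k))"
    by simp
  moreover have "log 2 (real k) > 0"
    using assms(1) by simp
  ultimately have "2 powr real (4 * h) \<le> log 2 (real k)"
    using le_log_iff[of 2 "log 2 (real k)" "real (4 * h)"] by simp
  then have "real (2 ^ (4 * h)) \<le> log 2 (real k)"
    using powr_realpow[of 2 "4 * h"] by simp
  then have "2 powr real (2 ^ (4 * h)) \<le> real k"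
    using assms(1) le_log_iff[of 2 "real k" "real (2 ^ (4 * h))"] by simp
  then have "(2::real) ^ (2 ^ (4 * h)) \<le> real k"
    using powr_realpow[of 2 "2 ^ (4 * h)"] by simp
  then have k: "2 ^ 2 ^ (4 * h) \<le> k"
    using of_nat_le_iff[where 'a = real, of "2 ^ 2 ^ (4 * h)" k] by simp
  have h1: "1 \<le> h"
    using nat_mono[OF assms(2)] by (simp only: h nat_1 One_nat_def)
  \<comment> \<open>It suffices that \<open>2 ^ (h + 5) <= k\<close>: one half of this power is the
    main term, the other absorbs the summand \<open>h\<close>.\<close>
  have "h + 5 \<le> 8 * h"
    using h1 by linarith
  also have "\<dots> \<le> 2 ^ (4 * h)"
  proof -
    have "8 * h \<le> 8 * 2 ^ h" by (simp add: less_imp_le)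
    also have "\<dots> = 2 ^ (h + 3)" by (simp add: power_add)
    also have "\<dots> \<le> 2 ^ (4 * h)" using h1 by (intro power_increasing) auto
    finally show ?thesis .
  qed
  finally have "(2::nat) ^ (h + 5) \<le> 2 ^ 2 ^ (4 * h)"
    by (intro power_increasing) auto
  moreover have "(2::nat) ^ (h + 5) = 2 ^ (h + 4) + 2 ^ (h + 4)"
    by (simp add: power_add)
  moreover have "h \<le> 2 ^ (h + 4)"
    using less_exp[of "h + 4"] by linarith
  ultimately show ?thesis
    using k h1 by linarith
qed

theorem theorem1p2:
  shows "\<exists>(c::real) (q::nat \<Rightarrow> nat). c > 0 \<and>
    (\<forall>k\<ge>1. \<forall>\<^sub>F t in sequentially.
       ramsey_number (2 * k + 1) (balanced_hedgehog (2 * k + 1) t) 2 \<le> t ^ (k + 3) \<and>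
       (k \<ge> 2 \<and> \<lfloor>c * log 2 (log 2 (real k))\<rfloor> \<ge> 1 \<longrightarrow>
          ramsey_number (2 * k + 1) (balanced_hedgehog (2 * k + 1) t) (q k)
            \<ge> tower (nat \<lfloor>c * log 2 (log 2 (real k))\<rfloor>) t))"
proof -
  let ?l = "\<lambda>k. \<lfloor>1 / 4 * log 2 (log 2 (real k))\<rfloor>"
  \<comment> \<open>The height is a function of \<open>k\<close>, so a number of colours can be
    chosen for each \<open>k\<close>; outside the range of the lower bound its value is
    arbitrary.\<close>
  have "\<forall>k. \<exists>q. k \<ge> 2 \<and> ?l k \<ge> 1 \<longrightarrow> (\<forall>\<^sub>F t in sequentially. tower (nat (?l k)) t
      \<le> ramsey_number (2 * k + 1) (balanced_hedgehog (2 * k + 1) t) q)"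
    using hedgehog_ramsey_lower_bound height_le_if_log_log by blast
  from choice[OF this] obtain q where q: "\<forall>k. k \<ge> 2 \<and> ?l k \<ge> 1 \<longrightarrow> (\<forall>\<^sub>F t in sequentially. tower (nat (?l k)) t
      \<le> ramsey_number (2 * k + 1) (balanced_hedgehog (2 * k + 1) t) (q k))"
    ..
  show ?thesis
  proof (intro exI conjI allI impI)
    show "(1 / 4 :: real) > 0" by simp
    fix k :: nat assume "k \<ge> 1"
    have "\<forall>\<^sub>F t in sequentially. k \<ge> 2 \<and> ?l k \<ge> 1 \<longrightarrow> tower (nat (?l k)) t
      \<le> ramsey_number (2 * k + 1) (balanced_hedgehog (2 * k + 1) t) (q k)"
      using q by (cases "k \<ge> 2 \<and> ?l k \<ge> 1") auto
    then show "\<forall>\<^sub>F t in sequentially.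
       ramsey_number (2 * k + 1) (balanced_hedgehog (2 * k + 1) t) 2 \<le> t ^ (k + 3) \<and>
       (k \<ge> 2 \<and> ?l k \<ge> 1 \<longrightarrow>
          ramsey_number (2 * k + 1) (balanced_hedgehog (2 * k + 1) t) (q k) \<ge> tower (nat (?l k)) t)"
      using hedgehog_ramsey_upper_bound[of k] by eventually_elim simp
  qed
qed

end
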